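(* Let $G$ be a finite, simple, connected $K_{1,4}$-free graph. If $\sigma_{7}(G) \geq |G|$, then $G$ has a spanning tree whose reducible stem is a path.
   Context: All graphs are finite and simple; $|G|$ denotes the number of vertices of $G$ and $\deg_G(v)$ the degree of $v$ in $G$. A graph is $K_{1,4}$-free if it contains no induced subgraph isomorphic to the star $K_{1,4}$. For an integer $p\geq 2$, $\sigma_p(G)$ is the minimum of $\sum_{x\in S}\deg_G(x)$ over all independent sets $S\subseteq V(G)$ with $|S|=p$; by convention $\sigma_p(G)=+\infty$ if $G$ has no independent set of size $p$. For a tree $T$, a leaf is a vertex of degree one and a branch vertex is a vertex of degree at least three. For a leaf $x$ of $T$, let $y_x$ be the branch vertex of $T$ nearest to $x$, and let $P_T[x,y_x)$ be the path in $T$ from $x$ to $y_x$ not including $y_x$ (the leaf-branch path incident to $x$). The reducible stem of $T$ is the subtree obtained from $T$ by deleting $P_T[x,y_x)$ for every leaf $x$ of $T$; equivalently, it is the smallest subtree of $T$ containing all branch vertices of $T$. *)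

theory Defs
  imports "Graph_Theory.Graph_Theory" "HOL-Library.Extended_Nat"
begin

text \<open>
  Finite simple graphs are the \<^locale>\<open>graph\<close>s of the library: finite symmetric digraphs
  without loops and parallel arcs, each undirected edge being a pair of opposite arcs. The degree
  of a vertex is therefore its out-degree.
\<close>

abbreviation deg :: "('a,'b) pre_digraph \<Rightarrow> 'a \<Rightarrow> nat" where
  "deg G v \<equiv> out_degree G v"

definition K14_free :: "('a,'b) pre_digraph \<Rightarrow> bool" where
  "K14_free G \<longleftrightarrow> \<not> (\<exists>H. induced_subgraph H G \<and> K\<^bsub>1,4\<^esub> H)"

definition independent_set :: "('a,'b) pre_digraph \<Rightarrow> 'a set \<Rightarrow> bool" where
  "independent_set G S \<longleftrightarrow> S \<subseteq> verts G \<and> (\<forall>u\<in>S. \<forall>v\<in>S. \<not> u \<rightarrow>\<^bsub>G\<^esub> v)"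

text \<open>
  The infimum of the empty set in \<^typ>\<open>enat\<close> is \<open>\<infinity>\<close>, which is the convention for graphs
  without an independent set of size \<open>p\<close>.
\<close>

definition sigma :: "nat \<Rightarrow> ('a,'b) pre_digraph \<Rightarrow> enat" where
  "sigma p G = (INF S\<in>{S. independent_set G S \<and> card S = p}. enat (\<Sum>x\<in>S. deg G x))"

text \<open>
  The library predicates \<^const>\<open>tree\<close> and \<^const>\<open>spanning_tree\<close> do not describe undirected
  trees: in a symmetric digraph every edge \<open>a b\<close> gives a cycle \<open>a, b, a\<close>, and an acyclic
  orientation of an undirected cycle is a \<^const>\<open>tree\<close>. Here the undirected cycles of a graph
  are its cycles of length at least three.
\<close>

definition undirected_tree :: "('a,'b) pre_digraph \<Rightarrow> bool" where
  "undirected_tree T \<longleftrightarrow>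
     graph T \<and> connected T \<and> \<not> (\<exists>c. pre_digraph.cycle T c \<and> 3 \<le> length c)"

definition undirected_spanning_tree :: "('a,'b) pre_digraph \<Rightarrow> ('a,'b) pre_digraph \<Rightarrow> bool" where
  "undirected_spanning_tree T G \<longleftrightarrow> undirected_tree T \<and> spanning T G"

definition leaf :: "('a,'b) pre_digraph \<Rightarrow> 'a \<Rightarrow> bool" where
  "leaf T x \<longleftrightarrow> x \<in> verts T \<and> deg T x = 1"

definition branch_vertex :: "('a,'b) pre_digraph \<Rightarrow> 'a \<Rightarrow> bool" where
  "branch_vertex T y \<longleftrightarrow> y \<in> verts T \<and> deg T y \<ge> 3"

text \<open>
  \<open>p\<close> is the path from the leaf \<open>x\<close> to a nearest branch vertex \<open>y\<close>: no path from \<open>x\<close> to any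
  branch vertex is shorter.
\<close>

definition leaf_branch_path :: "('a,'b) pre_digraph \<Rightarrow> 'a \<Rightarrow> 'b awalk \<Rightarrow> 'a \<Rightarrow> bool" where
  "leaf_branch_path T x p y \<longleftrightarrow>
     leaf T x \<and> branch_vertex T y \<and> pre_digraph.apath T x p y \<and>
     (\<forall>z q. branch_vertex T z \<and> pre_digraph.apath T x q z \<longrightarrow> length p \<le> length q)"

text \<open>
  If \<open>T\<close> has no branch vertex, there are no leaf-branch paths, nothing is deleted and the
  reducible stem is \<open>T\<close> itself, which is then a path.
\<close>

definition reducible_stem :: "('a,'b) pre_digraph \<Rightarrow> ('a,'b) pre_digraph" where
  "reducible_stem T =
     T \<restriction> (verts T - \<Union> {set (pre_digraph.awalk_verts T x p) - {y} | x p y. leaf_branch_path T x p y})"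

definition path_graph :: "('a,'b) pre_digraph \<Rightarrow> bool" where
  "path_graph P \<longleftrightarrow> graph P \<and>
     (\<exists>vs. vs \<noteq> [] \<and> distinct vs \<and> verts P = set vs \<and>
       arcs_ends P = {(vs ! i, vs ! j) | i j.
         i < length vs \<and> j < length vs \<and> (j = Suc i \<or> i = Suc j)})"

end

theory Submission
  imports Defs
begin

text \<open>
  Suppose every spanning tree is bad, i.e. has a reducible stem with a vertex of degree at least
  three. Counting degrees, a bad tree has at least six leaves, and if it has exactly six, its only
  branch vertices are a center \<open>c\<close> and one vertex of degree three in each of the three directions at
  \<open>c\<close>. Let \<open>T\<close> be a spanning tree with the fewest leaves, and let \<open>S\<close> be its set of leaves,
  together with \<open>c\<close> if there are only six of them. Map each pair \<open>(s, w)\<close> with \<open>s \<in> S\<close> and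
  \<open>w\<close> a neighbour of \<open>s\<close> in \<open>G\<close> to the last edge of the path from \<open>s\<close> to \<open>w\<close> in \<open>T\<close>. If
  two pairs had the same edge, or if \<open>S\<close> were not independent, then a few edge exchanges (where
  \<open>K\<^bsub>1,4\<^esub>\<close>-freeness supplies an edge among the neighbours of \<open>w\<close>) would give a tree with fewer
  leaves, or one with at most six leaves in which \<open>c\<close> has degree four, or one that is not bad.
  Hence the degrees in \<open>S\<close> sum to at most the number \<open>|G| - 1\<close> of edges of \<open>T\<close>.
\<close>

section \<open>Trees as sets of edges\<close>

text \<open>Against a leaf \<open>y\<close> and a second sink \<open>s\<close>, the typical sequence
  of exchanges has one fixed net effect on degrees: with \<open>{a, b}\<close> the last edge of the
  leg of \<open>y\<close> and \<open>b\<close> its branch vertex, the degrees of \<open>a\<close>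
  and \<open>b\<close> drop by one and those of \<open>s\<close> and \<open>y\<close> rise by one.
  So \<open>a\<close> at worst replaces \<open>y\<close> as a leaf, \<open>b\<close> has degree to
  spare, and \<open>s\<close> either stops being a leaf or, if it is the center, reaches degree
  four. This is why leaf count and degree four are the only contradictions needed in most cases,
  however many edges are moved. The claw appears when \<open>y\<close> and \<open>s\<close> are both
  adjacent to \<open>w\<close> and lie in the same direction \<open>u\<close> from it: its ends are
  \<open>y\<close>, \<open>s\<close>, \<open>u\<close> and a further tree neighbour \<open>z\<close>
  of \<open>w\<close>. The obstacle is that the center has no leg and cannot play the part of
  \<open>y\<close>. Among any two sinks one is a leaf, but configurations in which the roles of the
  two would have to be swapped need an argument that uses badness of the new tree itself rather than
  its leaf count.\<close>

definition conn :: "'a set set \<Rightarrow> 'a \<Rightarrow> 'a \<Rightarrow> bool" where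
  "conn T = (\<lambda>a b. {a, b} \<in> T)\<^sup>*\<^sup>*"

definition vdeg :: "'a set set \<Rightarrow> 'a \<Rightarrow> nat" where
  "vdeg T v = card {e \<in> T. v \<in> e}"

text \<open>For a tree edge the ordered pair encodes a direction: this is the branch hanging off
  \<open>b\<close> through \<open>a\<close>. Legs, directions at a vertex and last edges of tree
  paths are all expressed by it, which largely replaces reasoning about walks.\<close>

definition side :: "'a set set \<Rightarrow> 'a \<Rightarrow> 'a \<Rightarrow> 'a set" where
  "side T a b = {v. conn (T - {{a, b}}) a v}"

lemma conn_refl [simp]: "conn T a a"
  by (simp add: conn_def)

lemma conn_edge: "{a, b} \<in> T \<Longrightarrow> conn T a b"
  unfolding conn_def by auto

lemma conn_trans: "conn T a b \<Longrightarrow> conn T b c \<Longrightarrow> conn T a c"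
  unfolding conn_def by auto

lemma conn_sym: "conn T a b \<Longrightarrow> conn T b a"
  unfolding conn_def
proof (induction rule: rtranclp_induct)
  case (step y z)
  then have "{z, y} \<in> T" by (simp add: insert_commute)
  with step(3) show ?case by (rule converse_rtranclp_into_rtranclp[rotated])
qed simp

lemma conn_mono: "conn T a b \<Longrightarrow> T \<subseteq> T' \<Longrightarrow> conn T' a b"
  unfolding conn_def by (erule rtranclp_mono[THEN predicate2D, rotated]) auto

lemma conn_closed:
  assumes "conn T a b" "a \<in> M" "\<And>p q. p \<in> M \<Longrightarrow> {p, q} \<in> T \<Longrightarrow> q \<in> M"
  shows "b \<in> M"
  using assms(1) unfolding conn_def
  by (induction rule: rtranclp_induct) (use assms(2,3) in auto)

lemma conn_via:
  assumes "conn T a b" "\<And>p q. {p, q} \<in> T \<Longrightarrow> conn T' p q"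
  shows "conn T' a b"
proof -
  have "b \<in> {v. conn T' a v}"
    by (rule conn_closed[OF assms(1)]) (auto intro: conn_trans assms(2))
  then show ?thesis by simp
qed

lemma side_self [simp]: "a \<in> side T a b"
  by (simp add: side_def)

lemma side_step:
  assumes "p \<in> side T a b" "{p, q} \<in> T"
  shows "q \<in> side T a b \<or> (p = a \<and> q = b) \<or> (p = b \<and> q = a)"
  using assms conn_trans[OF _ conn_edge, of "T - {{a,b}}" a p q]
  by (auto simp: side_def doubleton_eq_iff)

lemma side_subset:
  assumes "a \<in> M" "\<And>p q. p \<in> M \<Longrightarrow> {p, q} \<in> T \<Longrightarrow> {p, q} \<noteq> {a, b} \<Longrightarrow> q \<in> M"
  shows "side T a b \<subseteq> M"
  using conn_closed[of "T - {{a,b}}" a _ M] assms by (auto simp: side_def)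

lemma side_swap: "side T b a = {v. conn (T - {{a, b}}) b v}"
  by (simp add: side_def insert_commute)

lemma same_side:
  assumes "p \<in> side T a b" "q \<in> side T a b" shows "conn (T - {{a, b}}) p q"
  using assms conn_trans[OF conn_sym] unfolding side_def mem_Collect_eq by metis

section \<open>Spanning trees of a finite graph\<close>

locale edge_graph =
  fixes V :: "'a set" and E :: "'a set set"
  assumes finite_V: "finite V"
    and edge: "e \<in> E \<Longrightarrow> e \<subseteq> V \<and> card e = 2"
begin

lemma edgeD: "{a, b} \<in> E \<Longrightarrow> a \<in> V \<and> b \<in> V \<and> a \<noteq> b"
  using edge[of "{a,b}"] by (cases "a = b") auto

lemma finite_E: "finite E"
  using finite_V edge by (intro finite_subset[of E "Pow V"]) auto

lemma edge_cases:
  assumes "e \<in> E" obtains a b where "e = {a, b}" "a \<in> V" "b \<in> V" "a \<noteq> b"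
  using edge[OF assms] by (auto simp: card_2_iff)

text \<open>The edge count stands in for acyclicity, which \<open>bridge\<close> recovers. An
  exchange then only has to preserve connectivity and the count.\<close>

definition spanning_tree_edges :: "'a set set \<Rightarrow> bool" where
  "spanning_tree_edges T \<longleftrightarrow>
     T \<subseteq> E \<and> (\<forall>x\<in>V. \<forall>y\<in>V. conn T x y) \<and> card T + 1 = card V"

text \<open>Each vertex but the root has an edge to a vertex closer to the root; the edges chosen
  in this way are distinct.\<close>

lemma ex_parent_edges:
  assumes "T \<subseteq> E" "r \<in> V" "\<And>v. v \<in> V \<Longrightarrow> conn T r v"
  obtains T' where "T' \<subseteq> T" "\<And>v. v \<in> V \<Longrightarrow> conn T' r v" "card T' + 1 = card V"
proof -
  define R where "R = (\<lambda>a b. {a, b} \<in> T)"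
  define h where "h v = (LEAST n. (R ^^ n) r v)" for v
  have h: "(R ^^ h v) r v" if "v \<in> V" for v
  proof -
    have "\<exists>n. (R ^^ n) r v"
      using assms(3)[OF that] unfolding conn_def R_def by (simp add: rtranclp_power)
    then show ?thesis unfolding h_def by (rule LeastI_ex)
  qed
  have h_le: "h v \<le> n" if "(R ^^ n) r v" for v n
    unfolding h_def using that by (rule Least_le)
  have "\<exists>p. p \<in> V \<and> {v, p} \<in> T \<and> h p < h v" if v: "v \<in> V - {r}" for v
  proof -
    have "h v \<noteq> 0"
    proof
      assume "h v = 0"
      then have "r = v" using h[of v] v by auto
      then show False using v by simp
    qed
    then obtain n where n: "h v = Suc n" using not0_implies_Suc by blast
    then obtain p where p: "(R ^^ n) r p" "R p v" using h[of v] v by auto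
    then have "{v, p} \<in> T" by (simp add: R_def insert_commute)
    then have "p \<in> V" using assms(1) edgeD by blast
    with h_le[OF p(1)] n \<open>{v, p} \<in> T\<close> show ?thesis by auto
  qed
  then obtain p where p: "\<And>v. v \<in> V - {r} \<Longrightarrow> p v \<in> V \<and> {v, p v} \<in> T \<and> h (p v) < h v"
    by metis
  define T' where "T' = (\<lambda>v. {v, p v}) ` (V - {r})"
  have "inj_on (\<lambda>v. {v, p v}) (V - {r})"
  proof (rule inj_onI)
    fix v w assume v: "v \<in> V - {r}" and w: "w \<in> V - {r}" and eq: "{v, p v} = {w, p w}"
    show "v = w"
    proof (rule ccontr)
      assume "v \<noteq> w"
      then have "v = p w" "w = p v" using eq by (auto simp: doubleton_eq_iff)
      then show False using p[OF v] p[OF w] by auto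
    qed
  qed
  then have "card T' = card (V - {r})" unfolding T'_def by (rule card_image)
  moreover have "card (V - {r}) + 1 = card V"
    using finite_V assms(2) by (metis Suc_eq_plus1 card_Suc_Diff1)
  ultimately have "card T' + 1 = card V" by simp
  moreover have "T' \<subseteq> T" using p by (auto simp: T'_def)
  moreover have "conn T' r v" if "v \<in> V" for v
    using that
  proof (induction "h v" arbitrary: v rule: less_induct)
    case less
    show ?case
    proof (cases "v = r")
      case False
      then have pv: "p v \<in> V" "h (p v) < h v" using p[of v] less(2) by auto
      have "{p v, v} \<in> T'"
        unfolding T'_def using False less(2) by (auto simp: insert_commute)
      then show ?thesis by (rule conn_trans[OF less(1)[OF pv(2,1)] conn_edge])
    qed simp
  qed
  ultimately show ?thesis using that by blast
qed

lemma ex_spanning_tree: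
  assumes "V \<noteq> {}" "\<And>x y. x \<in> V \<Longrightarrow> y \<in> V \<Longrightarrow> conn E x y"
  obtains T where "spanning_tree_edges T"
proof -
  obtain r where r: "r \<in> V" using assms(1) by auto
  obtain T where "T \<subseteq> E" "\<And>v. v \<in> V \<Longrightarrow> conn T r v" "card T + 1 = card V"
    using ex_parent_edges[OF subset_refl r assms(2)[OF r]] by metis
  then have "spanning_tree_edges T"
    unfolding spanning_tree_edges_def using conn_sym conn_trans by metis
  then show ?thesis using that by blast
qed

definition leaves :: "'a set set \<Rightarrow> 'a set" where
  "leaves T = {v \<in> V. vdeg T v = 1}"

definition branches :: "'a set set \<Rightarrow> 'a set" where
  "branches T = {v \<in> V. vdeg T v \<ge> 3}"

definition branchy :: "'a set set \<Rightarrow> 'a \<Rightarrow> 'a \<Rightarrow> bool" where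
  "branchy T a b \<longleftrightarrow> (\<exists>v\<in>side T a b. vdeg T v \<ge> 3)"

text \<open>A spanning tree is bad iff its reducible stem has a vertex of degree at least three.\<close>

definition bad :: "'a set set \<Rightarrow> bool" where
  "bad T \<longleftrightarrow> (\<exists>c N. card N = 3 \<and> (\<forall>n\<in>N. {n, c} \<in> T \<and> branchy T n c))"

text \<open>Unlike in \<open>bad\<close>, every direction has to be branchy. This is what prevents a
  leg from ending at a center; with at most six leaves a bad tree has such a vertex because its
  degrees are at most three.\<close>

definition center :: "'a set set \<Rightarrow> 'a \<Rightarrow> bool" where
  "center T c \<longleftrightarrow> vdeg T c \<ge> 3 \<and> (\<forall>n. {n, c} \<in> T \<longrightarrow> branchy T n c)"

lemma finite_leaves: "finite (leaves T)"
  using finite_V by (simp add: leaves_def)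

lemma finite_branches: "finite (branches T)"
  using finite_V by (simp add: branches_def)

section \<open>Deleting and exchanging tree edges\<close>

context
  fixes T assumes tree: "spanning_tree_edges T"
begin

lemma tree_sub: "T \<subseteq> E"
  using tree by (simp add: spanning_tree_edges_def)

lemma tree_conn: "x \<in> V \<Longrightarrow> y \<in> V \<Longrightarrow> conn T x y"
  using tree by (simp add: spanning_tree_edges_def)

lemma finite_T: "finite T"
  using tree_sub finite_E by (rule finite_subset)

lemma tree_edgeD: "{a, b} \<in> T \<Longrightarrow> a \<in> V \<and> b \<in> V \<and> a \<noteq> b"
  using tree_sub edgeD by blast

text \<open>Otherwise \<open>T\<close> without the edge still connects \<open>V\<close>, and parent
  edges chosen inside it already number \<open>card V - 1\<close>, too many for a proper subset of
  \<open>T\<close>.\<close>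

lemma bridge:
  assumes ab: "{a, b} \<in> T" shows "\<not> conn (T - {{a, b}}) a b"
proof
  assume *: "conn (T - {{a, b}}) a b"
  have "conn (T - {{a, b}}) p q" if "{p, q} \<in> T" for p q
    using that * conn_sym[OF *] conn_edge[of p q "T - {{a,b}}"]
    by (cases "{p, q} = {a, b}") (simp_all add: doubleton_eq_iff, blast)
  then have "conn (T - {{a, b}}) a v" if "v \<in> V" for v
    using conn_via[OF tree_conn] tree_edgeD[OF ab] that by metis
  moreover have "T - {{a, b}} \<subseteq> E" "a \<in> V" using tree_sub tree_edgeD[OF ab] by auto
  ultimately obtain T' where T': "T' \<subseteq> T - {{a, b}}" "card T' + 1 = card V"
    using ex_parent_edges[of "T - {{a, b}}" a] by metis
  have "card T' < card T"
    using T'(1) ab finite_T by (intro psubset_card_mono) auto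
  then show False using T'(2) tree by (simp add: spanning_tree_edges_def)
qed

lemma side_sub: "{a, b} \<in> T \<Longrightarrow> side T a b \<subseteq> V"
  using side_subset[of a V T b] tree_edgeD by metis

lemma side_not: "{a, b} \<in> T \<Longrightarrow> b \<notin> side T a b"
  using bridge by (simp add: side_def)

lemma side_leave:
  assumes "{a, b} \<in> T" "p \<in> side T a b" "{p, q} \<in> T" "q \<notin> side T a b"
  shows "p = a" "q = b"
  using side_step[OF assms(2,3)] side_not[OF assms(1)] assms(2,4) side_self by metis+

lemma side_disj: "{a, b} \<in> T \<Longrightarrow> v \<in> side T a b \<Longrightarrow> v \<notin> side T b a"
  unfolding side_swap[of T b a] unfolding side_def mem_Collect_eq
  using bridge[of a b] conn_trans[OF _ conn_sym] by metis

lemma side_cover: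
  assumes "{a, b} \<in> T" "v \<in> V" shows "v \<in> side T a b \<or> v \<in> side T b a"
proof -
  have "v \<in> side T a b \<union> side T b a"
  proof (rule conn_closed[OF tree_conn[of a v]])
    fix p q assume "p \<in> side T a b \<union> side T b a" "{p, q} \<in> T"
    then show "q \<in> side T a b \<union> side T b a"
      using side_step[of p T a b q] side_step[of p T b a q] by auto
  qed (use assms tree_edgeD[OF assms(1)] in auto)
  then show ?thesis by simp
qed

lemma separated_iff:
  assumes "p \<in> side T a b"
  shows "conn (T - {{a, b}}) p q \<longleftrightarrow> q \<in> side T a b"
  using same_side[OF assms, of q] conn_trans[of "T - {{a,b}}" a p q] assms
  unfolding side_def by blast

lemma exchange:
  assumes ab: "{a, b} \<in> T" and pq: "{p, q} \<in> E" "\<not> conn (T - {{a, b}}) p q"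
  shows "spanning_tree_edges (insert {p, q} (T - {{a, b}}))" (is "spanning_tree_edges ?T'")
proof -
  have pqV: "p \<in> V" "q \<in> V" using edgeD[OF pq(1)] by auto
  have sides: "(p \<in> side T a b \<and> q \<in> side T b a) \<or> (q \<in> side T a b \<and> p \<in> side T b a)"
    using side_cover[OF ab pqV(1)] side_cover[OF ab pqV(2)] pq(2)
      same_side[of p T a b q] same_side[of p T b a q, unfolded insert_commute[of b a "{}"]]
    by argo
  have mono: "conn ?T' x y" if "conn (T - {{a, b}}) x y" for x y
    using that by (rule conn_mono) auto
  have pq': "conn ?T' p q" by (rule conn_edge) simp
  have ab': "conn ?T' a b"
    using sides
  proof (elim disjE conjE)
    assume "p \<in> side T a b" "q \<in> side T b a"
    then have "conn ?T' a p" "conn ?T' b q"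
      using mono[of a p] mono[of b q] unfolding side_swap[of T b a] by (auto simp: side_def)
    then show ?thesis using conn_trans[OF conn_trans[OF _ pq'] conn_sym] conn_trans[OF conn_trans[OF _ conn_sym[OF pq']] conn_sym] by metis
  next
    assume "q \<in> side T a b" "p \<in> side T b a"
    then have "conn ?T' a q" "conn ?T' b p"
      using mono[of a q] mono[of b p] unfolding side_swap[of T b a] by (auto simp: side_def)
    then show ?thesis using conn_trans[OF conn_trans[OF _ pq'] conn_sym] conn_trans[OF conn_trans[OF _ conn_sym[OF pq']] conn_sym] by metis
  qed
  have "conn ?T' x y" if "{x, y} \<in> T" for x y
    using that ab' conn_sym[OF ab'] conn_edge[of x y ?T']
    unfolding doubleton_eq_iff by (cases "{x, y} = {a, b}") (simp_all add: doubleton_eq_iff, blast)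
  then have "\<forall>x\<in>V. \<forall>y\<in>V. conn ?T' x y"
    using conn_via[OF tree_conn] by metis
  moreover have "{p, q} \<notin> T - {{a, b}}" using pq(2) conn_edge by metis
  then have "card ?T' = card T"
    using finite_T ab card_Suc_Diff1[OF finite_T ab] by simp
  ultimately show ?thesis
    using tree pq(1) unfolding spanning_tree_edges_def by auto
qed

text \<open>Losses stand on the left to avoid truncated subtraction, and the indicators add up
  correctly when endpoints coincide. Equations of this form can be summed over several
  exchanges.\<close>

lemma exchange_vdeg:
  assumes ab: "{a, b} \<in> T" and pq: "{p, q} \<in> E" "\<not> conn (T - {{a, b}}) p q"
  shows "vdeg (insert {p, q} (T - {{a, b}})) v + of_bool (v = a) + of_bool (v = b)
    = vdeg T v + of_bool (v = p) + of_bool (v = q)"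
proof -
  have new: "{p, q} \<notin> T - {{a, b}}" using pq(2) conn_edge by metis
  have fin: "finite {e \<in> T - {{a, b}}. v \<in> e}" using finite_T by simp
  have "{e \<in> T. v \<in> e}
      = (if v \<in> {a, b} then insert {a, b} {e \<in> T - {{a, b}}. v \<in> e} else {e \<in> T - {{a, b}}. v \<in> e})"
    using ab by auto
  then have 1: "vdeg T v = card {e \<in> T - {{a, b}}. v \<in> e} + of_bool (v \<in> {a, b})"
    unfolding vdeg_def using fin by auto
  have "{e \<in> insert {p, q} (T - {{a, b}}). v \<in> e}
      = (if v \<in> {p, q} then insert {p, q} {e \<in> T - {{a, b}}. v \<in> e} else {e \<in> T - {{a, b}}. v \<in> e})"
    by auto
  then have 2: "vdeg (insert {p, q} (T - {{a, b}})) v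
      = card {e \<in> T - {{a, b}}. v \<in> e} + of_bool (v \<in> {p, q})"
    unfolding vdeg_def using fin new by auto
  have "a \<noteq> b" "p \<noteq> q" using tree_edgeD[OF ab] edgeD[OF pq(1)] by auto
  then show ?thesis using 1 2 by (auto split: if_splits)
qed

section \<open>The directions at a vertex\<close>

lemma side_nested:
  assumes "{u, w} \<in> T" "{w, z} \<in> T" "u \<noteq> z"
  shows "side T u w \<subseteq> side T w z"
proof -
  have u: "u \<in> side T w z"
    using side_step[of w T w z u] assms side_self by (metis insert_commute)
  have "side T u w \<subseteq> side T u w \<inter> side T w z"
  proof (rule side_subset)
    fix p q assume p: "p \<in> side T u w \<inter> side T w z" and pq: "{p, q} \<in> T" "{p, q} \<noteq> {u, w}"
    then have "p \<noteq> w" using side_not[OF assms(1)] by auto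
    then show "q \<in> side T u w \<inter> side T w z"
      using p pq side_leave[OF assms(1)] side_leave[OF assms(2)] by blast
  qed (use u in simp)
  then show ?thesis by simp
qed

lemma ex_side:
  assumes "w \<in> V" "s \<in> V" "s \<noteq> w"
  obtains u where "{u, w} \<in> T" "s \<in> side T u w"
proof -
  have "s \<in> insert w (\<Union>u\<in>{u. {u, w} \<in> T}. side T u w)"
  proof (rule conn_closed[OF tree_conn[OF assms(1,2)]])
    fix p q assume p: "p \<in> insert w (\<Union>u\<in>{u. {u, w} \<in> T}. side T u w)" and pq: "{p, q} \<in> T"
    consider "p = w" | u where "{u, w} \<in> T" "p \<in> side T u w" using p by auto
    then show "q \<in> insert w (\<Union>u\<in>{u. {u, w} \<in> T}. side T u w)"
    proof cases
      case 1
      then have "{q, w} \<in> T" using pq by (simp add: insert_commute)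
      then show ?thesis using side_self[of q T w] by blast
    next
      case 2
      then show ?thesis using side_leave[OF 2(1,2) pq] by blast
    qed
  qed simp
  then show ?thesis using assms(3) that by auto
qed

lemma side_unique:
  assumes "{u, w} \<in> T" "{u', w} \<in> T" "s \<in> side T u w" "s \<in> side T u' w"
  shows "u = u'"
  using side_nested[of u w u'] side_disj[OF assms(2,4)] assms
  by (auto simp: insert_commute)

lemma side_decomp:
  assumes "{a, b} \<in> T" "v \<in> side T a b" "v \<noteq> a"
  obtains n where "{n, a} \<in> T" "n \<noteq> b" "v \<in> side T n a"
proof -
  have "a \<in> V" "v \<in> V" using tree_edgeD[OF assms(1)] side_sub[OF assms(1)] assms(2) by auto
  then obtain n where n: "{n, a} \<in> T" "v \<in> side T n a" using ex_side assms(3) by metis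
  moreover have "n \<noteq> b" using n side_disj[OF assms(1,2)] by auto
  ultimately show ?thesis using that by blast
qed

lemma side_psubset:
  assumes "{n, a} \<in> T" "{a, b} \<in> T" "n \<noteq> b"
  shows "card (side T n a) < card (side T a b)"
proof (rule psubset_card_mono)
  show "finite (side T a b)" using side_sub[OF assms(2)] finite_V finite_subset by blast
  show "side T n a \<subset> side T a b"
    using side_nested[OF assms] side_not[OF assms(1)] side_self[of a T b] by blast
qed

lemma ex_other_nbr:
  assumes "vdeg T w \<ge> 2"
  obtains z where "{w, z} \<in> T" "z \<noteq> u"
proof -
  have "\<exists>e\<in>T. w \<in> e \<and> e \<noteq> {w, u}"
  proof (rule ccontr)
    assume "\<not> ?thesis"
    then have "{e \<in> T. w \<in> e} \<subseteq> {{w, u}}" by auto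
    then have "card {e \<in> T. w \<in> e} \<le> 1"
      using card_mono[of "{{w,u}}"] by fastforce
    then show False using assms by (simp add: vdeg_def)
  qed
  then obtain e where e: "e \<in> T" "w \<in> e" "e \<noteq> {w, u}" by auto
  then obtain z where "e = {w, z}"
    using edge_cases[of e] tree_sub by (metis insert_commute insert_iff singletonD subsetD)
  then show ?thesis using that e by auto
qed

lemma nbrs_le_vdeg:
  assumes "\<And>n. n \<in> N \<Longrightarrow> {n, v} \<in> T"
  shows "card N \<le> vdeg T v"
proof -
  have "inj_on (\<lambda>n. {n, v}) N" by (auto simp: inj_on_def doubleton_eq_iff)
  moreover have "(\<lambda>n. {n, v}) ` N \<subseteq> {e \<in> T. v \<in> e}" using assms by auto
  ultimately show ?thesis unfolding vdeg_def using finite_T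
    by (intro card_inj_on_le[of "\<lambda>n. {n, v}"]) auto
qed

lemma vdeg_nbrs: "vdeg T v = card {n. {n, v} \<in> T}"
proof -
  have "bij_betw (\<lambda>n. {n, v}) {n. {n, v} \<in> T} {e \<in> T. v \<in> e}"
    unfolding bij_betw_def
  proof
    show "inj_on (\<lambda>n. {n, v}) {n. {n, v} \<in> T}" by (auto simp: inj_on_def doubleton_eq_iff)
    show "(\<lambda>n. {n, v}) ` {n. {n, v} \<in> T} = {e \<in> T. v \<in> e}"
    proof (intro equalityI subsetI)
      fix e assume e: "e \<in> {e \<in> T. v \<in> e}"
      then obtain x y where "e = {x, y}" using edge_cases tree_sub by (metis (lifting) mem_Collect_eq subsetD)
      then have "e = {x, v} \<or> e = {y, v}" using e by auto
      then show "e \<in> (\<lambda>n. {n, v}) ` {n. {n, v} \<in> T}" using e by auto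
    qed auto
  qed
  then show ?thesis unfolding vdeg_def by (rule bij_betw_same_card[symmetric])
qed

lemma vdeg_pos:
  assumes "v \<in> V" "w \<in> V" "v \<noteq> w" shows "vdeg T v \<ge> 1"
proof -
  obtain u where "{u, v} \<in> T" using ex_side[of v w] assms by metis
  then show ?thesis using nbrs_le_vdeg[of "{u}" v] by simp
qed

section \<open>Leaves and legs\<close>

lemma ex_leaf_side:
  assumes "{a, b} \<in> T" shows "\<exists>x\<in>side T a b. x \<in> leaves T"
  using assms
proof (induction "card (side T a b)" arbitrary: a b rule: less_induct)
  case less
  have a: "a \<in> V" using tree_edgeD less(2) by blast
  show ?case
  proof (cases "vdeg T a \<ge> 2")
    case True
    then obtain z where z: "{a, z} \<in> T" "z \<noteq> b" using ex_other_nbr by metis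
    then have z': "{z, a} \<in> T" by (simp add: insert_commute)
    obtain x where "x \<in> side T z a" "x \<in> leaves T"
      using less(1)[OF side_psubset[OF z' less(2) z(2)] z'] by auto
    then show ?thesis using side_nested[OF z' less(2) z(2)] by blast
  next
    case False
    then have "vdeg T a = 1" using nbrs_le_vdeg[of "{b}" a] less(2) by (simp add: insert_commute)
    then show ?thesis using a by (intro bexI[of _ a]) (simp_all add: leaves_def)
  qed
qed

text \<open>Without a branch vertex the side is a path starting at \<open>a\<close>: moving away
  from \<open>b\<close> there is at most one way to continue, and the induction follows it through
  ever smaller sides.\<close>

lemma unique_leaf_side:
  assumes "{a, b} \<in> T" "\<not> branchy T a b"
    and "x \<in> side T a b" "x \<in> leaves T" "y \<in> side T a b" "y \<in> leaves T"
  shows "x = y"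
  using assms
proof (induction "card (side T a b)" arbitrary: a b rule: less_induct)
  case less
  have nbr: "\<exists>z. {z, a} \<in> T \<and> z \<noteq> b \<and> v \<in> side T z a \<and> vdeg T a \<ge> 2"
    if v: "v \<in> side T a b" "v \<noteq> a" for v
  proof -
    obtain z where z: "{z, a} \<in> T" "z \<noteq> b" "v \<in> side T z a"
      using side_decomp[OF less(2) v] by metis
    moreover have "vdeg T a \<ge> card {z, b}"
      using z(1) less(2) by (intro nbrs_le_vdeg) (auto simp: insert_commute)
    ultimately show ?thesis using z(2) by auto
  qed
  show ?case
  proof (cases "vdeg T a = 1")
    case True
    then show ?thesis using nbr[OF less(4)] nbr[OF less(6)] by force
  next
    case False
    then have "x \<noteq> a" "y \<noteq> a" using less by (auto simp: leaves_def)
    then obtain z z' where z: "{z, a} \<in> T" "z \<noteq> b" "x \<in> side T z a"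
      and z': "{z', a} \<in> T" "z' \<noteq> b" "y \<in> side T z' a"
      using nbr[OF less(4)] nbr[OF less(6)] by auto
    have "z = z'"
    proof (rule ccontr)
      assume "z \<noteq> z'"
      then have "card {z, z', b} \<le> vdeg T a"
        using z(1) z'(1) less(2) by (intro nbrs_le_vdeg) (auto simp: insert_commute)
      then have "vdeg T a \<ge> 3" using \<open>z \<noteq> z'\<close> z(2) z'(2) by simp
      then show False using less(3) unfolding branchy_def using side_self[of a T b] by blast
    qed
    have sub: "side T z a \<subseteq> side T a b" by (rule side_nested[OF z(1) less(2) z(2)])
    then have "\<not> branchy T z a" using less(3) by (auto simp: branchy_def)
    then show ?thesis
      using less(1)[OF side_psubset[OF z(1) less(2) z(2)] z(1)] z(3) z'(3) less(5,7) \<open>z = z'\<close>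
      by blast
  qed
qed

text \<open>Take a largest branch-free side containing \<open>x\<close>. If \<open>b\<close> were
  not a branch vertex, the branch vertex \<open>v\<close> beyond it would force exactly one further
  neighbour \<open>m\<close> of \<open>b\<close>, and \<open>side T b m\<close> would be a larger
  branch-free side.\<close>

lemma ex_leg:
  assumes x: "x \<in> leaves T" and "branches T \<noteq> {}"
  obtains a b where "{a, b} \<in> T" "x \<in> side T a b" "vdeg T b \<ge> 3" "\<not> branchy T a b"
proof -
  define P where "P = (\<lambda>(a, b). {a, b} \<in> T \<and> x \<in> side T a b \<and> \<not> branchy T a b)"
  obtain v where v: "v \<in> V" "vdeg T v \<ge> 3" using assms(2) by (auto simp: branches_def)
  have xV: "x \<in> V" "vdeg T x = 1" using x by (auto simp: leaves_def)
  then have "v \<noteq> x" using v by auto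
  then obtain n where n: "{n, x} \<in> T" using ex_side[OF xV(1) v(1)] by metis
  have nx: "{x, n} \<in> T" using n by (simp add: insert_commute)
  have only: "m = n" if "{m, x} \<in> T" for m
  proof (rule ccontr)
    assume "m \<noteq> n"
    then have "card {m, n} \<le> vdeg T x" using n that by (intro nbrs_le_vdeg) auto
    then show False using \<open>m \<noteq> n\<close> xV(2) by simp
  qed
  have "side T x n \<subseteq> {x}"
  proof
    fix u assume u: "u \<in> side T x n"
    show "u \<in> {x}"
    proof (rule ccontr)
      assume "u \<notin> {x}"
      then obtain m where "{m, x} \<in> T" "m \<noteq> n" using side_decomp[OF nx u] by auto
      then show False using only by blast
    qed
  qed
  then have "P (x, n)" unfolding P_def branchy_def using nx xV(2) by auto
  moreover have "\<forall>e. P e \<longrightarrow> card (side T (fst e) (snd e)) < Suc (card V)"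
    unfolding P_def using card_mono[OF finite_V side_sub] by (auto simp: less_Suc_eq_le)
  ultimately have "\<exists>e. P e \<and> (\<forall>f. P f \<longrightarrow> card (side T (fst f) (snd f)) \<le> card (side T (fst e) (snd e)))"
    by (rule ex_has_greatest_nat)
  then obtain a b where ab: "P (a, b)"
    and max: "\<And>a' b'. P (a', b') \<Longrightarrow> card (side T a' b') \<le> card (side T a b)" by fastforce
  have e: "{a, b} \<in> T" "x \<in> side T a b" "\<not> branchy T a b" using ab by (auto simp: P_def)
  have ba: "{b, a} \<in> T" using e(1) by (simp add: insert_commute)
  have "vdeg T b \<ge> 3"
  proof (rule ccontr)
    assume b3: "\<not> vdeg T b \<ge> 3"
    have "v \<notin> side T a b" using e(3) v(2) by (auto simp: branchy_def)
    then have "v \<in> side T b a" "v \<noteq> b" using side_cover[OF e(1) v(1)] b3 v(2) by auto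
    then obtain m where m: "{m, b} \<in> T" "m \<noteq> a" using side_decomp[OF ba] by metis
    have bm: "{b, m} \<in> T" using m(1) by (simp add: insert_commute)
    have sub: "side T a b \<subseteq> side T b m" using side_nested[OF e(1) bm] m(2) by auto
    have "u \<in> side T a b" if u: "u \<in> side T b m" "u \<noteq> b" for u
    proof -
      obtain k where k: "{k, b} \<in> T" "k \<noteq> m" "u \<in> side T k b"
        using side_decomp[OF bm u] by metis
      have "k = a"
      proof (rule ccontr)
        assume "k \<noteq> a"
        then have "card {k, m, a} \<le> vdeg T b" using k m e by (intro nbrs_le_vdeg) auto
        then show False using \<open>k \<noteq> a\<close> k(2) m(2) b3 by simp
      qed
      then show ?thesis using k by simp
    qed
    then have "P (b, m)"
      unfolding P_def branchy_def using bm sub e b3 by (auto simp: branchy_def)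
    then have "card (side T b m) \<le> card (side T a b)" by (rule max)
    then show False using side_psubset[OF e(1) bm] m(2) by auto
  qed
  then show ?thesis using that e by blast
qed

section \<open>Counting leaves by degrees\<close>

lemma sum_vdeg: "(\<Sum>v\<in>V. vdeg T v) = 2 * card T"
proof -
  have fin: "finite T" by (rule finite_T)
  have "(\<Sum>v\<in>V. vdeg T v) = (\<Sum>v\<in>V. \<Sum>e\<in>T. if v \<in> e then 1 else 0)"
    unfolding vdeg_def using fin
    by (intro sum.cong refl) (simp add: sum.If_cases Int_def)
  also have "\<dots> = (\<Sum>e\<in>T. \<Sum>v\<in>V. if v \<in> e then 1 else 0)" by (rule sum.swap)
  also have "\<dots> = (\<Sum>e\<in>T. 2)"
  proof (intro sum.cong refl)
    fix e assume "e \<in> T"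
    then have "e \<subseteq> V" "card e = 2" using edge tree_sub by auto
    then show "(\<Sum>v\<in>V. if v \<in> e then 1 else 0) = (2::nat)"
      using finite_V by (simp add: sum.If_cases Int_absorb1 Int_def[symmetric])
  qed
  finally show ?thesis by simp
qed

text \<open>The numbers \<open>vdeg T v - 2\<close> sum to \<open>-2\<close> over \<open>V\<close>.
  Degree two contributes nothing, a leaf contributes \<open>-1\<close>, and with two vertices in a
  connected graph no degree is zero.\<close>

lemma card_leaves:
  assumes "card V \<ge> 2"
  shows "card (leaves T) + 2 * card (branches T) = 2 + (\<Sum>v\<in>branches T. vdeg T v)"
proof -
  have pos: "vdeg T v \<ge> 1" if "v \<in> V" for v
  proof -
    have "\<not> V \<subseteq> {v}" using assms card_mono[of "{v}" V] by auto
    then obtain w where "w \<in> V" "v \<noteq> w" by auto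
    then show ?thesis using vdeg_pos[OF that] by blast
  qed
  have "(\<Sum>v\<in>V. int (vdeg T v) - 2) = 2 * int (card T) - 2 * int (card V)"
    using sum_vdeg by (simp add: sum_subtractf flip: of_nat_sum)
  also have "\<dots> = - 2" using tree by (simp add: spanning_tree_edges_def)
  finally have 1: "(\<Sum>v\<in>V. int (vdeg T v) - 2) = - 2" .
  have "(\<Sum>v\<in>V. int (vdeg T v) - 2) = (\<Sum>v\<in>leaves T \<union> branches T. int (vdeg T v) - 2)"
    using finite_V pos
    by (intro sum.mono_neutral_right)
      (auto simp: leaves_def branches_def, metis One_nat_def Suc_1 le_Suc_eq le_antisym not_less_eq_eq numeral_3_eq_3)
  also have "\<dots> = (\<Sum>v\<in>leaves T. int (vdeg T v) - 2) + (\<Sum>v\<in>branches T. int (vdeg T v) - 2)"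
    by (rule sum.union_disjoint[OF finite_leaves finite_branches]) (auto simp: leaves_def branches_def)
  also have "(\<Sum>v\<in>leaves T. int (vdeg T v) - 2) = (\<Sum>v\<in>leaves T. - 1)"
    by (intro sum.cong) (auto simp: leaves_def)
  finally have "- int (card (leaves T)) + (int (\<Sum>v\<in>branches T. vdeg T v) - 2 * int (card (branches T))) = - 2"
    using 1 by (simp add: sum_subtractf)
  then show ?thesis by linarith
qed

text \<open>The four are \<open>c\<close> and one branch vertex in each of its three branchy
  directions.\<close>

lemma bad_branches:
  assumes "bad T" shows "card (branches T) \<ge> 4" "card V \<ge> 2"
proof -
  obtain c N where N: "card N = 3" "\<And>n. n \<in> N \<Longrightarrow> {n, c} \<in> T" "\<And>n. n \<in> N \<Longrightarrow> branchy T n c"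
    using assms unfolding bad_def by blast
  have "N \<noteq> {}" using N(1) by auto
  then have cV: "c \<in> V" using N(2) tree_edgeD by blast
  have "vdeg T c \<ge> 3" using nbrs_le_vdeg[of N c] N by simp
  then have c: "c \<in> branches T" using cV by (simp add: branches_def)
  obtain f where f: "\<And>n. n \<in> N \<Longrightarrow> f n \<in> side T n c \<and> vdeg T (f n) \<ge> 3"
    using N(3) unfolding branchy_def by metis
  have inj: "inj_on f N"
    using side_unique N(2) f by (metis inj_onI)
  have "insert c (f ` N) \<subseteq> branches T"
    using f side_sub[OF N(2)] c unfolding branches_def by blast
  moreover have "c \<notin> f ` N" using f side_not[OF N(2)] by auto
  then have "card (insert c (f ` N)) = 4"
    using inj N(1) by (simp add: card_image card_ge_0_finite)
  ultimately show 4: "card (branches T) \<ge> 4" using card_mono[OF finite_branches] by metis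
  have "card (branches T) \<le> card V" by (rule card_mono[OF finite_V]) (auto simp: branches_def)
  then show "card V \<ge> 2" using 4 by simp
qed

text \<open>The number of leaves is two plus the sum of \<open>vdeg - 2\<close> over the branch
  vertices, each term being at least one. With six leaves there is no slack for a fifth branch
  vertex or for a degree above three.\<close>

lemma bad_leaves:
  assumes "bad T"
  shows "card (leaves T) \<ge> 6"
    and "card (leaves T) \<le> 6 \<Longrightarrow> card (branches T) = 4 \<and> (\<forall>v. vdeg T v \<le> 3)"
proof -
  have *: "card (leaves T) + 2 * card (branches T) = 2 + (\<Sum>v\<in>branches T. vdeg T v)"
    using card_leaves bad_branches[OF assms] by blast
  have "(\<Sum>v\<in>branches T. vdeg T v) \<ge> (\<Sum>v\<in>branches T. 3)"
    by (rule sum_mono) (simp add: branches_def)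
  then have **: "(\<Sum>v\<in>branches T. vdeg T v) \<ge> 3 * card (branches T)" by simp
  show "card (leaves T) \<ge> 6" using * ** bad_branches[OF assms] by linarith
  assume "card (leaves T) \<le> 6"
  then have 4: "card (branches T) = 4" and s: "(\<Sum>v\<in>branches T. vdeg T v) = 12"
    using * ** bad_branches[OF assms] by linarith+
  have "vdeg T v \<le> 3" for v
  proof (cases "v \<in> branches T")
    case True
    have "(\<Sum>u\<in>branches T - {v}. vdeg T u) \<ge> (\<Sum>u\<in>branches T - {v}. 3)"
      by (rule sum_mono) (simp add: branches_def)
    then have "(\<Sum>u\<in>branches T - {v}. vdeg T u) \<ge> 9"
      using 4 True finite_branches by simp
    then show ?thesis using s sum.remove[OF finite_branches True, of "vdeg T"] by linarith
  next
    case False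
    have "vdeg T v = 0" if "v \<notin> V"
    proof -
      have "{e \<in> T. v \<in> e} = {}" using that edge tree_sub by blast
      then show ?thesis unfolding vdeg_def by (simp only: card.empty)
    qed
    then show ?thesis using False by (cases "v \<in> V") (auto simp: branches_def)
  qed
  then show "card (branches T) = 4 \<and> (\<forall>v. vdeg T v \<le> 3)" using 4 by blast
qed

section \<open>The center of a bad tree with six leaves\<close>

lemma centerD:
  assumes "center T c"
  shows "c \<in> V" "c \<in> branches T"
proof -
  have "{e \<in> T. c \<in> e} \<noteq> {}" using assms unfolding center_def vdeg_def by force
  then show "c \<in> V" using edge tree_sub by blast
  then show "c \<in> branches T" using assms by (simp add: center_def branches_def)
qed

lemma ex_center:
  assumes "bad T" "card (leaves T) \<le> 6"
  obtains c where "center T c"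
proof -
  obtain c N where N: "card N = 3" "\<And>n. n \<in> N \<Longrightarrow> {n, c} \<in> T" "\<And>n. n \<in> N \<Longrightarrow> branchy T n c"
    using assms(1) unfolding bad_def by blast
  have c3: "vdeg T c \<ge> 3" using nbrs_le_vdeg[of N c] N by simp
  have "n \<in> N" if "{n, c} \<in> T" for n
  proof (rule ccontr)
    assume "n \<notin> N"
    then have "card (insert n N) = 4" using N(1) by (simp add: card_ge_0_finite)
    moreover have "card (insert n N) \<le> vdeg T c" using that N(2) by (intro nbrs_le_vdeg) auto
    moreover have "vdeg T c \<le> 3" using bad_leaves(2)[OF assms] by blast
    ultimately show False by linarith
  qed
  then show ?thesis using that c3 N(3) unfolding center_def by blast
qed

text \<open>The center and one branch vertex in each of its three directions use up all four branch
  vertices.\<close>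

lemma center_nonbranchy:
  assumes "bad T" "card (leaves T) \<le> 6" "center T c" "b \<in> branches T" "b \<noteq> c"
    and nb: "{n, b} \<in> T" "c \<notin> side T n b"
  shows "\<not> branchy T n b"
proof
  assume "branchy T n b"
  then obtain v where v: "v \<in> side T n b" "vdeg T v \<ge> 3" by (auto simp: branchy_def)
  have bV: "b \<in> V" using assms(4) by (simp add: branches_def)
  obtain g where g: "{g, c} \<in> T" "b \<in> side T g c"
    using ex_side[OF centerD(1)[OF assms(3)] bV assms(5)] by metis
  have bn: "{b, n} \<in> T" using nb(1) by (simp add: insert_commute)
  \<comment> \<open>The branch at \<open>b\<close> through \<open>n\<close> stays in the direction
    \<open>g\<close> of \<open>b\<close> seen from \<open>c\<close>. So \<open>v\<close> would be a
    fifth branch vertex besides \<open>c\<close>, \<open>b\<close> and one in each of two other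
    directions at \<open>c\<close>.\<close>
  have "n \<in> side T g c" using side_leave[OF g(1,2) bn] nb(2) side_self by metis
  then have "side T n b \<subseteq> side T n b \<inter> side T g c"
    using side_leave[OF g(1)] side_leave[OF nb(1)] assms(5) nb(2)
    by (intro side_subset) (auto, metis+)
  then have vg: "v \<in> side T g c" using v(1) by blast
  have "card {n. {n, c} \<in> T} \<ge> 3"
    using assms(3) vdeg_nbrs[of c] by (simp add: center_def)
  then have "card ({n. {n, c} \<in> T} - {g}) \<ge> 2" using g(1) by simp
  then obtain N where N: "N \<subseteq> {n. {n, c} \<in> T} - {g}" "card N = 2"
    by (meson obtain_subset_with_card_n)
  then have "\<forall>n\<in>N. branchy T n c" using assms(3) by (auto simp: center_def)
  then obtain f where f: "\<And>n. n \<in> N \<Longrightarrow> f n \<in> side T n c \<and> vdeg T (f n) \<ge> 3"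
    unfolding branchy_def by metis
  have Nc: "{n, c} \<in> T" "n \<noteq> g" if "n \<in> N" for n using that N by auto
  have inj: "inj_on f N" using side_unique Nc f by (metis inj_onI)
  have disj: "x \<notin> f ` N" if "x \<in> {c, b, v}" for x
    using that g vg side_unique[OF g(1)] Nc f side_not by (metis imageE insertE singletonD)
  have "card (f ` N) = 2" using inj N(2) by (simp add: card_image)
  moreover have "finite (f ` N)" using N(2) by (simp add: card_ge_0_finite)
  moreover have "card {c, b, v} = 3"
    using assms(5) v(1) vg side_not[OF g(1)] side_not[OF nb(1)] by (subst card_3_iff) blast
  ultimately have "card ({c, b, v} \<union> f ` N) = 5"
    using disj by (subst card_Un_disjoint) auto
  moreover have "{c, b, v} \<union> f ` N \<subseteq> branches T"
    using centerD[OF assms(3)] assms(4) v f side_sub[OF Nc(1)] side_sub[OF nb(1)]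
    unfolding branches_def by blast
  ultimately have "card (branches T) \<ge> 5" using card_mono[OF finite_branches] by metis
  then show False using bad_leaves(2)[OF assms(1,2)] by simp
qed

text \<open>Each of \<open>c\<close> and \<open>y\<close> lies in at most one direction from
  \<open>b\<close>, and there are at least three directions.\<close>

lemma ex_nbr_avoiding:
  assumes "vdeg T b \<ge> 3"
  obtains n where "{n, b} \<in> T" "c \<notin> side T n b" "y \<notin> side T n b"
proof -
  define N where "N = {n. {n, b} \<in> T}"
  have card: "card N \<ge> 3" using assms vdeg_nbrs[of b] by (simp add: N_def)
  then have fin: "finite N" by (intro card_ge_0_finite) simp
  have le: "card {n \<in> N. s \<in> side T n b} \<le> 1" for s
    using side_unique unfolding N_def
    by (intro card_le_Suc0_iff_eq[THEN iffD2, unfolded One_nat_def[symmetric]])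
      (use fin in \<open>auto simp: N_def\<close>)
  have "card ({n \<in> N. c \<in> side T n b} \<union> {n \<in> N. y \<in> side T n b}) \<le> 2"
    using card_Un_le[of "{n \<in> N. c \<in> side T n b}" "{n \<in> N. y \<in> side T n b}"] le[of c] le[of y]
    by linarith
  then have "\<not> N \<subseteq> {n \<in> N. c \<in> side T n b} \<union> {n \<in> N. y \<in> side T n b}"
    using card_mono[of "{n \<in> N. c \<in> side T n b} \<union> {n \<in> N. y \<in> side T n b}" N] fin card by auto
  then show ?thesis using that unfolding N_def by blast
qed

end

end

section \<open>Edge exchanges\<close>

lemma not_conn:
  assumes "p \<in> M" "q \<notin> M" "\<And>x y. x \<in> M \<Longrightarrow> {x, y} \<in> T \<Longrightarrow> y \<in> M"
  shows "\<not> conn T p q"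
  using conn_closed[of T p q M] assms by blast

context edge_graph
begin

text \<open>The degrees change as in a single exchange, but \<open>T'\<close> may be the result of several. The
  exchanges are \<open>- uw + yw - ab + us\<close> in \<open>net_opposite\<close>, \<open>- uw + sw - ab + yu\<close> in \<open>net_parallel\<close> and
  \<open>- uw + sw - ab + yw - wz + uz\<close> in \<open>net_bypass\<close>.\<close>

definition net :: "'a set set \<Rightarrow> 'a set set \<Rightarrow> 'a \<Rightarrow> 'a \<Rightarrow> 'a \<Rightarrow> 'a \<Rightarrow> bool" where
  "net T T' a b s z \<longleftrightarrow> spanning_tree_edges T' \<and>
     (\<forall>v. vdeg T' v + of_bool (v = a) + of_bool (v = b)
        = vdeg T v + of_bool (v = s) + of_bool (v = z))"

text \<open>For a leaf \<open>y\<close>, \<open>side T a b\<close> is its leaf-branch path without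
  the branch vertex \<open>b\<close>, and \<open>a\<close> is the last vertex of that path.\<close>

definition leg :: "'a set set \<Rightarrow> 'a \<Rightarrow> 'a \<Rightarrow> 'a \<Rightarrow> bool" where
  "leg T y a b \<longleftrightarrow> {a, b} \<in> T \<and> y \<in> side T a b \<and> vdeg T b \<ge> 3 \<and> \<not> branchy T a b"

lemma net_exchange:
  assumes "spanning_tree_edges T" "{a, b} \<in> T" "{p, q} \<in> E" "\<not> conn (T - {{a, b}}) p q"
  shows "net T (insert {p, q} (T - {{a, b}})) a b p q"
  using exchange[OF assms] exchange_vdeg[OF assms] by (simp add: net_def)

context
  fixes T assumes tree: "spanning_tree_edges T"
begin

lemma net_adjacent:
  assumes "{a, b} \<in> T" "y \<in> side T a b" "s \<notin> side T a b" "{s, y} \<in> E"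
  shows "\<exists>T'. net T T' a b s y"
proof -
  have "\<not> conn (T - {{a, b}}) s y" using separated_iff[OF tree assms(2)] assms(3) conn_sym by metis
  then show ?thesis using net_exchange[OF tree assms(1,4)] by blast
qed

text \<open>The degrees of \<open>u\<close> and \<open>w\<close> cancel. What has to be checked is
  that \<open>{a, b}\<close> still separates \<open>u\<close> from \<open>s\<close> after the first
  exchange; the closed set that shows it depends on whether \<open>{u, w}\<close> lies inside
  \<open>side T a b\<close>.\<close>

lemma net_opposite:
  assumes ab: "{a, b} \<in> T" and uw: "{u, w} \<in> T" and ne: "{a, b} \<noteq> {u, w}"
    and y: "y \<in> side T a b" "y \<in> side T u w"
    and s: "s \<notin> side T a b" "s \<in> side T w u"
    and e: "{y, w} \<in> E" "{s, u} \<in> E"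
  shows "\<exists>T'. net T T' a b s y"
proof -
  define T1 where "T1 = insert {y, w} (T - {{u, w}})"
  have wu: "{w, u} \<in> T" using uw by (simp add: insert_commute)
  have "\<not> conn (T - {{u, w}}) y w"
    using separated_iff[OF tree y(2)] side_not[OF tree uw] by metis
  then have n1: "net T T1 u w y w" unfolding T1_def by (rule net_exchange[OF tree uw e(1)])
  have ab1: "{a, b} \<in> T1" using ab ne by (simp add: T1_def)
  have inA: "u \<in> side T a b \<longleftrightarrow> w \<in> side T a b"
    using side_leave[OF tree ab _ uw] side_leave[OF tree ab _ wu] ne by auto
  have "\<not> conn (T1 - {{a, b}}) u s"
  proof (cases "w \<in> side T a b")
    case True
    show ?thesis
    proof (rule not_conn[of _ "side T a b"])
      fix p q assume p: "p \<in> side T a b" and pq: "{p, q} \<in> T1 - {{a, b}}"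
      show "q \<in> side T a b"
      proof (cases "{p, q} \<in> T")
        case True
        then show ?thesis using side_leave[OF tree ab p] pq by blast
      next
        case False
        then have "q \<in> {y, w}" using pq unfolding T1_def by blast
        then show ?thesis using y(1) True by auto
      qed
    qed (use True inA s in auto)
  next
    \<comment> \<open>Now the part at \<open>u\<close> is attached only through \<open>y\<close>,
      which lies in \<open>side T a b\<close>. Hence \<open>side T u w\<close> without that side is
      closed once \<open>{a, b}\<close> is removed.\<close>
    case False
    show ?thesis
    proof (rule not_conn[of _ "side T u w - side T a b"])
      fix p q assume p: "p \<in> side T u w - side T a b" and pq: "{p, q} \<in> T1 - {{a, b}}"
      have "p \<noteq> y" "p \<noteq> w" using p y(1) side_not[OF tree uw] by auto
      then have pqT: "{p, q} \<in> T" "{p, q} \<noteq> {u, w}" using pq unfolding T1_def by auto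
      have qp: "{q, p} \<in> T" using pqT(1) by (simp add: insert_commute)
      have "q \<in> side T u w" using side_leave[OF tree uw _ pqT(1)] p pqT(2) by blast
      moreover have "q \<notin> side T a b"
      proof
        assume "q \<in> side T a b"
        then have "q = a" "p = b" using side_leave[OF tree ab _ qp] p by auto
        then show False using pq by (simp add: insert_commute)
      qed
      ultimately show "q \<in> side T u w - side T a b" by simp
    qed (use False inA side_disj[OF tree wu s(2)] in auto)
  qed
  moreover have "{u, s} \<in> E" using e(2) by (simp add: insert_commute)
  ultimately obtain T' where "net T1 T' a b u s"
    using net_exchange[OF _ ab1] n1 unfolding net_def by metis
  then have "net T T' a b s y" using n1 unfolding net_def by (smt (verit, best) add.commute add.left_commute add_left_cancel)
  then show ?thesis by blast
qed

text \<open>The common first exchange of \<open>net_parallel\<close> and \<open>net_bypass\<close>.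
  Neither end of the new edge \<open>{s, w}\<close> lies in \<open>side T a b\<close>, so deleting
  \<open>{a, b}\<close> still cuts this set off.\<close>

lemma net_shift:
  assumes ab: "{a, b} \<in> T" and uw: "{u, w} \<in> T" "u \<notin> side T a b" "w \<notin> side T a b"
    and y: "y \<in> side T a b" "y \<in> side T u w"
    and s: "s \<notin> side T a b" "s \<in> side T u w"
    and sw: "{s, w} \<in> E"
  obtains T1 where "net T T1 u w s w" "{a, b} \<in> T1" "T1 \<subseteq> insert {s, w} (T - {{u, w}})"
    and "T - {{u, w}} \<subseteq> T1" "\<And>v. v \<notin> side T a b \<Longrightarrow> \<not> conn (T1 - {{a, b}}) y v"
proof -
  define T1 where "T1 = insert {s, w} (T - {{u, w}})"
  have "\<not> conn (T - {{u, w}}) s w"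
    using separated_iff[OF tree s(2)] side_not[OF tree uw(1)] by metis
  then have n1: "net T T1 u w s w" unfolding T1_def by (rule net_exchange[OF tree uw(1) sw])
  have "{a, b} \<noteq> {u, w}" using uw(2,3) side_self[of a T b] by (metis doubleton_eq_iff)
  then have ab1: "{a, b} \<in> T1" using ab by (simp add: T1_def)
  have "\<not> conn (T1 - {{a, b}}) y v" if "v \<notin> side T a b" for v
  proof (rule not_conn[OF y(1) that])
    fix p q assume p: "p \<in> side T a b" and pq: "{p, q} \<in> T1 - {{a, b}}"
    then have "p \<noteq> s" "p \<noteq> w" using s uw by auto
    then have "{p, q} \<in> T" using pq unfolding T1_def by auto
    then show "q \<in> side T a b" using side_leave[OF tree ab p] pq by blast
  qed
  then show ?thesis using that[OF n1 ab1] by (auto simp: T1_def)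
qed

lemma net_parallel:
  assumes "{a, b} \<in> T" "{u, w} \<in> T" "u \<notin> side T a b" "w \<notin> side T a b"
    and "y \<in> side T a b" "y \<in> side T u w" "s \<notin> side T a b" "s \<in> side T u w"
    and "{s, w} \<in> E" "{y, u} \<in> E"
  shows "\<exists>T'. net T T' a b s y"
proof -
  obtain T1 where n1: "net T T1 u w s w" and ab: "{a, b} \<in> T1"
    and sep: "\<And>v. v \<notin> side T a b \<Longrightarrow> \<not> conn (T1 - {{a, b}}) y v"
    using net_shift[OF assms(1-9)] by metis
  then obtain T' where "net T1 T' a b y u"
    using net_exchange[OF _ ab assms(10) sep[OF assms(3)]] n1 unfolding net_def by metis
  then have "net T T' a b s y" using n1 unfolding net_def by (smt (verit, best) add.commute add.left_commute add_left_cancel)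
  then show ?thesis by blast
qed

text \<open>Attaching both \<open>s\<close> and \<open>y\<close> to \<open>w\<close> shifts one
  degree from \<open>u\<close> to \<open>w\<close>; replacing \<open>{w, z}\<close> by
  \<open>{u, z}\<close> shifts it back.\<close>

lemma net_bypass:
  assumes ab: "{a, b} \<in> T" and uw: "{u, w} \<in> T" and uwA: "u \<notin> side T a b" "w \<notin> side T a b"
    and y: "y \<in> side T a b" "y \<in> side T u w" and s: "s \<notin> side T a b" "s \<in> side T u w"
    and sw: "{s, w} \<in> E" and yw: "{y, w} \<in> E" and wz: "{w, z} \<in> T" "z \<noteq> u" and uz: "{u, z} \<in> E"
  shows "\<exists>T'. net T T' a b s y"
proof -
  obtain T1 where n1: "net T T1 u w s w" and ab1: "{a, b} \<in> T1"
    and T1: "T1 \<subseteq> insert {s, w} (T - {{u, w}})" "T - {{u, w}} \<subseteq> T1"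
    and sep: "\<And>v. v \<notin> side T a b \<Longrightarrow> \<not> conn (T1 - {{a, b}}) y v"
    using net_shift[OF ab uw uwA y s sw] by metis
  define T2 where "T2 = insert {y, w} (T1 - {{a, b}})"
  have n2: "net T1 T2 a b y w"
    unfolding T2_def using net_exchange[OF _ ab1 yw sep[OF uwA(2)]] n1 by (simp add: net_def)
  have zw: "{z, w} \<in> T" using wz by (simp add: insert_commute)
  have wu: "{w, u} \<in> T" using uw by (simp add: insert_commute)
  have sub: "side T z w \<subseteq> side T w u" by (rule side_nested[OF tree zw wu wz(2)])
  have out: "v \<notin> side T z w" if "v \<in> side T u w" for v
    using side_disj[OF tree uw that] sub by blast
  have "{w, z} \<noteq> {a, b}"
  proof
    assume "{w, z} = {a, b}"
    then have "a = z" "b = w" using uwA(2) side_self[of a T b] by (metis doubleton_eq_iff)+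
    then show False using out[OF y(2)] y(1) by simp
  qed
  moreover have "{w, z} \<noteq> {u, w}" using wz(2) by (auto simp: doubleton_eq_iff)
  ultimately have wz2: "{w, z} \<in> T2" using wz(1) T1(2) by (auto simp: T2_def)
  \<comment> \<open>The branch beyond \<open>z\<close> contains none of \<open>s\<close>,
    \<open>y\<close>, \<open>w\<close>, so both new edges miss it and it is closed once
    \<open>{w, z}\<close> is removed.\<close>
  have "\<not> conn (T2 - {{w, z}}) z u"
  proof (rule not_conn[of _ "side T z w"])
    fix p q assume p: "p \<in> side T z w" and pq: "{p, q} \<in> T2 - {{w, z}}"
    have "p \<noteq> s" "p \<noteq> y" "p \<noteq> w" using p out[OF s(2)] out[OF y(2)] side_not[OF tree zw] by auto
    then have "{p, q} \<in> T" using pq T1(1) unfolding T2_def by auto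
    then show "q \<in> side T z w" using side_leave[OF tree zw p] pq by (metis DiffD2 insertI1 insert_commute)
  qed (use out[of u] in auto)
  then have "\<not> conn (T2 - {{w, z}}) u z" using conn_sym by metis
  then obtain T' where "net T2 T' w z u z"
    using net_exchange[OF _ wz2 uz] n2 unfolding net_def by metis
  then have "net T T' a b s y" using n1 n2 unfolding net_def by (smt (verit, best) add.commute add.left_commute add_left_cancel)
  then show ?thesis by blast
qed

text \<open>Suppose \<open>w\<close> is in the leg side. The tree path from \<open>y\<close> to
  \<open>s\<close> stays in \<open>side T u w\<close> and leaves the leg side through
  \<open>a\<close>, so \<open>a\<close> is in \<open>side T u w\<close>. Then
  \<open>side T w u\<close> cannot leave the leg side and contributes a leaf to it, but
  \<open>y\<close> is the only leaf there and is on the other side of \<open>{u, w}\<close>.\<close>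

lemma leg_disjoint:
  assumes leg: "leg T y a b" and leaf: "y \<in> leaves T" and s: "s \<notin> side T a b"
    and uw: "{u, w} \<in> T" "y \<in> side T u w" "s \<in> side T u w"
  shows "u \<notin> side T a b" "w \<notin> side T a b"
proof -
  have ab: "{a, b} \<in> T" and y: "y \<in> side T a b" and nb: "\<not> branchy T a b"
    using leg by (auto simp: leg_def)
  have wu: "{w, u} \<in> T" using uw by (simp add: insert_commute)
  have "\<not> (a = u \<and> b = w)" using s uw by auto
  moreover have "\<not> (a = w \<and> b = u)" using side_disj[OF tree uw(1,2)] y by auto
  ultimately have inA: "u \<in> side T a b \<longleftrightarrow> w \<in> side T a b"
    using side_leave[OF tree ab _ uw(1)] side_leave[OF tree ab _ wu] by metis
  have "w \<notin> side T a b"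
  proof
    assume w: "w \<in> side T a b"
    have aK: "a \<in> side T u w"
    proof (rule ccontr)
      assume "a \<notin> side T u w"
      then have "s \<in> side T a b \<inter> side T u w"
        using y uw side_leave[OF tree ab] side_leave[OF tree uw(1)]
        by (intro conn_closed[OF same_side[OF uw(2,3)]]) (auto, metis+)
      then show False using s by simp
    qed
    have "side T w u \<subseteq> side T w u \<inter> side T a b"
    proof (rule side_subset)
      fix p q assume p: "p \<in> side T w u \<inter> side T a b" and pq: "{p, q} \<in> T" "{p, q} \<noteq> {w, u}"
      then have "p \<noteq> a" using side_disj[OF tree uw(1) aK] by auto
      then show "q \<in> side T w u \<inter> side T a b"
        using p pq side_leave[OF tree ab _ pq(1)] side_leave[OF tree wu _ pq(1)] by auto
    qed (use w in simp)
    moreover obtain x where "x \<in> side T w u" "x \<in> leaves T" using ex_leaf_side[OF tree wu] by auto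
    ultimately have "y \<in> side T w u" using unique_leaf_side[OF tree ab nb y leaf, of x] by blast
    then show False using side_disj[OF tree uw(1,2)] by simp
  qed
  then show "u \<notin> side T a b" "w \<notin> side T a b" using inA by auto
qed

lemma leaf_side:
  assumes "{u, w} \<in> T" "y \<in> side T u w" "y \<noteq> u" shows "vdeg T u \<ge> 2"
proof -
  obtain n where "{n, u} \<in> T" "n \<noteq> w" using side_decomp[OF tree assms] by metis
  then have "\<And>m. m \<in> {n, w} \<Longrightarrow> {m, u} \<in> T" using assms(1) by (auto simp: insert_commute)
  then have "card {n, w} \<le> vdeg T u" by (rule nbrs_le_vdeg[OF tree])
  then show ?thesis using \<open>n \<noteq> w\<close> by simp
qed

end

lemma exists_leg:
  assumes "spanning_tree_edges T" "bad T" "y \<in> leaves T"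
  obtains a b where "leg T y a b"
proof -
  have "branches T \<noteq> {}" using bad_branches(1)[OF assms(1,2)] by auto
  then show ?thesis using ex_leg[OF assms(1,3)] that unfolding leg_def by metis
qed

end

section \<open>Spanning trees with the fewest leaves\<close>

context edge_graph
begin

text \<open>Degree is lost only at \<open>a\<close> and \<open>b\<close>, and \<open>b\<close> has
  enough to spare, so \<open>a\<close> is the only possible new leaf. The alternative
  \<open>z = a\<close> covers exchanges that keep an endpoint of the removed edge: loss and gain at
  \<open>a\<close> cancel.\<close>

lemma net_leaves:
  assumes tree: "spanning_tree_edges T" and net: "net T T' a b s z"
    and b: "vdeg T b \<ge> 3" and V: "card V \<ge> 2" and z: "z \<in> leaves T \<or> z = a"
  shows "leaves T' \<subseteq> (if z = a then leaves T else insert a (leaves T - {z}))"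
    and "s \<in> leaves T \<Longrightarrow> s \<noteq> a \<Longrightarrow> s \<notin> leaves T'"
proof -
  have deg: "vdeg T' v + of_bool (v = a) + of_bool (v = b) = vdeg T v + of_bool (v = s) + of_bool (v = z)"
    for v using net by (simp add: net_def)
  have pos: "vdeg T v \<ge> 1" if "v \<in> V" for v
  proof -
    have "\<not> V \<subseteq> {v}" using V card_mono[of "{v}" V] by auto
    then obtain w where "w \<in> V" "v \<noteq> w" by auto
    then show ?thesis using vdeg_pos[OF tree that] by blast
  qed
  have "v \<in> (if z = a then leaves T else insert a (leaves T - {z}))" if v: "v \<in> leaves T'" for v
  proof -
    have v1: "v \<in> V" "vdeg T' v = 1" using v by (auto simp: leaves_def)
    show ?thesis
    proof (cases "v = a \<and> z \<noteq> a")
      case False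
      then have "v \<noteq> b" using deg[of v] b v1 by (auto simp: of_bool_def split: if_splits)
      then show ?thesis
        using deg[of v] pos[OF v1(1)] v1 z False
        by (auto simp: leaves_def of_bool_def split: if_splits)
    qed simp
  qed
  then show "leaves T' \<subseteq> (if z = a then leaves T else insert a (leaves T - {z}))" by blast
  show "s \<notin> leaves T'" if "s \<in> leaves T" "s \<noteq> a"
    using deg[of s] that b by (auto simp: leaves_def of_bool_def split: if_splits)
qed

lemma net_card_leaves:
  assumes "spanning_tree_edges T" "net T T' a b s z" "vdeg T b \<ge> 3" "card V \<ge> 2"
    and "z \<in> leaves T \<or> z = a"
  shows "card (leaves T') \<le> card (leaves T)"
    and "s \<in> leaves T \<Longrightarrow> s \<noteq> a \<Longrightarrow> s \<noteq> z \<Longrightarrow> card (leaves T') < card (leaves T)"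
proof -
  define L where "L = (if z = a then leaves T else insert a (leaves T - {z}))"
  have fin: "finite L" using finite_leaves by (simp add: L_def)
  have L: "card L \<le> card (leaves T)"
  proof (cases "z = a")
    case False
    then have "z \<in> leaves T" using assms(5) by simp
    then have "Suc (card (leaves T - {z})) = card (leaves T)"
      by (rule card_Suc_Diff1[OF finite_leaves])
    then show ?thesis using False card_insert_le_m1[of "card (leaves T)" "leaves T - {z}" a]
      by (simp add: L_def finite_leaves card_insert_if)
  qed (simp add: L_def)
  have sub: "leaves T' \<subseteq> L" unfolding L_def by (rule net_leaves(1)[OF assms])
  then show "card (leaves T') \<le> card (leaves T)" using card_mono[OF fin] L by (meson order_trans)
  assume s: "s \<in> leaves T" "s \<noteq> a" "s \<noteq> z"
  have "s \<in> L" using s by (simp add: L_def)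
  moreover have "s \<notin> leaves T'" using net_leaves(2)[OF assms s(1,2)] .
  ultimately have "leaves T' \<subset> L" using sub by blast
  then show "card (leaves T') < card (leaves T)" using psubset_card_mono[OF fin] L by (meson less_le_trans)
qed

text \<open>Distinctness of \<open>a\<close> and \<open>b\<close> is implied, since edges have two
  elements.\<close>

definition claw4_free :: bool where
  "claw4_free \<longleftrightarrow> (\<forall>w A. card A = 4 \<longrightarrow> (\<forall>a\<in>A. {a, w} \<in> E) \<longrightarrow> (\<exists>a\<in>A. \<exists>b\<in>A. {a, b} \<in> E))"

definition indep :: "'a set \<Rightarrow> bool" where
  "indep S \<longleftrightarrow> (\<forall>a\<in>S. \<forall>b\<in>S. {a, b} \<notin> E)"

context
  assumes all_bad: "\<And>T. spanning_tree_edges T \<Longrightarrow> bad T"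
begin

lemma no_degree_4:
  assumes "spanning_tree_edges T" "card (leaves T) \<le> 6" shows "vdeg T v \<le> 3"
  using bad_leaves(2)[OF assms(1) all_bad[OF assms(1)] assms(2)] by blast

text \<open>The branch vertex \<open>s\<close> would reach degree four in a tree with at most six
  leaves, and all such trees are bad.\<close>

lemma net_branch_impossible:
  assumes "spanning_tree_edges T" "net T T' a b s z" "vdeg T b \<ge> 3" "z \<in> leaves T \<or> z = a"
    and "card (leaves T) \<le> 6" "vdeg T s \<ge> 3" "s \<noteq> a" "s \<noteq> b"
  shows False
proof -
  have "card (leaves T') \<le> 6"
    using net_card_leaves(1)[OF assms(1-3) bad_branches(2)[OF assms(1) all_bad[OF assms(1)]] assms(4)]
      assms(5) by simp
  moreover have T': "spanning_tree_edges T'" using assms(2) by (simp add: net_def)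
  ultimately have "vdeg T' s \<le> 3" by (intro no_degree_4)
  moreover have "vdeg T' s + of_bool (s = a) + of_bool (s = b) = vdeg T s + of_bool (s = s) + of_bool (s = z)"
    using assms(2) unfolding net_def by blast
  ultimately show False using assms(6-8) by simp
qed

context
  fixes T assumes tree: "spanning_tree_edges T"
    and min: "\<And>T'. spanning_tree_edges T' \<Longrightarrow> card (leaves T) \<le> card (leaves T')"
begin

text \<open>The sinks are the candidates for the sparse independent set.\<close>

definition sink :: "'a \<Rightarrow> bool" where
  "sink s \<longleftrightarrow> s \<in> leaves T \<or> (card (leaves T) \<le> 6 \<and> center T s)"

lemma bad: "bad T"
  by (rule all_bad[OF tree])

lemma card_V: "card V \<ge> 2"
  by (rule bad_branches(2)[OF tree bad])

lemma sink_V: "sink s \<Longrightarrow> s \<in> V"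
  using centerD(1)[OF tree] by (auto simp: sink_def leaves_def)

text \<open>The leg side has \<open>y\<close> as its only leaf and contains no branch vertex, hence
  no other sink. The end \<open>b\<close> is no leaf, and it is no center because its direction
  \<open>a\<close> is not branchy.\<close>

lemma sink_leg:
  assumes "sink s" "y \<in> leaves T" "s \<noteq> y" "leg T y a b"
  shows "s \<notin> side T a b" "s \<noteq> a" "s \<noteq> b"
proof -
  have ab: "{a, b} \<in> T" "y \<in> side T a b" "vdeg T b \<ge> 3" "\<not> branchy T a b"
    using assms(4) by (auto simp: leg_def)
  show s: "s \<notin> side T a b"
    using unique_leaf_side[OF tree ab(1,4) _ _ ab(2) assms(2)] ab(4) assms(1,3)
    unfolding sink_def center_def branchy_def by blast
  then show "s \<noteq> a" by auto
  show "s \<noteq> b" using assms(1) ab unfolding sink_def center_def leaves_def by auto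
qed

text \<open>A leaf \<open>s\<close> disappears, against the minimality of \<open>T\<close>; a center
  \<open>s\<close> would get degree four.\<close>

lemma net_impossible:
  assumes net: "net T T' a b s z" and b: "vdeg T b \<ge> 3" and z: "z \<in> leaves T \<or> z = a"
    and s: "sink s" "s \<noteq> a" "s \<noteq> b" "s \<noteq> z"
  shows False
proof (cases "s \<in> leaves T")
  case True
  have "spanning_tree_edges T'" using net by (simp add: net_def)
  then show ?thesis using net_card_leaves(2)[OF tree net b card_V z True s(2,4)] min by force
next
  case False
  then show ?thesis
    using net_branch_impossible[OF tree net b z _ _ s(2,3)] s(1) by (auto simp: sink_def center_def)
qed

section \<open>Excluded positions of two sinks\<close>

lemma leaf_sink_nonadjacent:
  assumes "y \<in> leaves T" "sink s" "s \<noteq> y" shows "{s, y} \<notin> E"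
proof
  assume e: "{s, y} \<in> E"
  obtain a b where leg: "leg T y a b" using exists_leg[OF tree bad assms(1)] .
  note out = sink_leg[OF assms(2,1,3) leg]
  obtain T' where "net T T' a b s y"
    using net_adjacent[OF tree _ _ out(1) e] leg by (auto simp: leg_def)
  then show False
    using net_impossible[OF _ _ _ assms(2) out(2,3) assms(3)] leg assms(1) by (auto simp: leg_def)
qed

lemma no_opposite:
  assumes "y \<in> leaves T" "sink s" "{u, w} \<in> T" "y \<in> side T u w" "s \<in> side T w u"
    and e: "{y, w} \<in> E" "{s, u} \<in> E"
  shows False
proof -
  have wu: "{w, u} \<in> T" using assms(3) by (simp add: insert_commute)
  have sy: "s \<noteq> y" using side_disj[OF tree assms(3,4)] assms(5) by auto
  obtain a b where leg: "leg T y a b" using exists_leg[OF tree bad assms(1)] .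
  then have ab: "{a, b} \<in> T" "y \<in> side T a b" "vdeg T b \<ge> 3" by (auto simp: leg_def)
  note out = sink_leg[OF assms(2,1) sy leg]
  show False
  proof (cases "{a, b} = {u, w}")
    case False
    then obtain T' where "net T T' a b s y"
      using net_opposite[OF tree ab(1) assms(3) False ab(2) assms(4) out(1) assms(5) e] by blast
    then show False using net_impossible[OF _ ab(3) _ assms(2) out(2,3) sy] assms(1) by blast
  next
    \<comment> \<open>Here \<open>{u, w}\<close> is itself the last edge of the leg. Replacing it by
      \<open>{s, u}\<close> is enough, and the degree of \<open>u\<close> is unchanged.\<close>
    case True
    have "\<not> (a = w \<and> b = u)" using side_disj[OF tree assms(3,4)] ab(2) by auto
    then have eq: "a = u" "b = w" using True by (auto simp: doubleton_eq_iff)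
    obtain T' where "net T T' u w s u"
      using net_adjacent[OF tree assms(3) side_self] out(1) e(2) eq by metis
    then show False using net_impossible[of T' u w s u] assms(2) out ab(3) eq by blast
  qed
qed

text \<open>The roles are not symmetric: \<open>y\<close> has to be a leaf because its leg supplies
  \<open>{a, b}\<close>, while \<open>s\<close> may be the center.\<close>

lemma no_parallel:
  assumes "y \<in> leaves T" "sink s" "s \<noteq> y" "{u, w} \<in> T" "y \<in> side T u w" "s \<in> side T u w"
    and e: "{s, w} \<in> E" "{y, u} \<in> E"
  shows False
proof -
  obtain a b where leg: "leg T y a b" using exists_leg[OF tree bad assms(1)] .
  then have ab: "{a, b} \<in> T" "y \<in> side T a b" "vdeg T b \<ge> 3" by (auto simp: leg_def)
  note out = sink_leg[OF assms(2,1,3) leg]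
  note uw = leg_disjoint[OF tree leg assms(1) out(1) assms(4-6)]
  obtain T' where "net T T' a b s y"
    using net_parallel[OF tree ab(1) assms(4) uw ab(2) assms(5) out(1) assms(6) e] by blast
  then show False using net_impossible[OF _ ab(3) _ assms(2) out(2,3) assms(3)] assms(1) by blast
qed

lemma no_bypass:
  assumes "y \<in> leaves T" "sink s" "s \<noteq> y" "{u, w} \<in> T" "y \<in> side T u w" "s \<in> side T u w"
    and e: "{s, w} \<in> E" "{y, w} \<in> E" and z: "{w, z} \<in> T" "z \<noteq> u"
  shows "{u, z} \<notin> E"
proof
  assume uz: "{u, z} \<in> E"
  obtain a b where leg: "leg T y a b" using exists_leg[OF tree bad assms(1)] .
  then have ab: "{a, b} \<in> T" "y \<in> side T a b" "vdeg T b \<ge> 3" by (auto simp: leg_def)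
  note out = sink_leg[OF assms(2,1,3) leg]
  note uw = leg_disjoint[OF tree leg assms(1) out(1) assms(4-6)]
  obtain T' where "net T T' a b s y"
    using net_bypass[OF tree ab(1) assms(4) uw ab(2) assms(5) out(1) assms(6) e z uz] by blast
  then show False using net_impossible[OF _ ab(3) _ assms(2) out(2,3) assms(3)] assms(1) by blast
qed

text \<open>Replacing \<open>{u, w}\<close> by \<open>{y, w}\<close> keeps the degree of
  \<open>w\<close>. If \<open>u\<close> had degree at least three, the leaf \<open>y\<close> would
  be lost and no leaf would arise.\<close>

lemma preceding_degree:
  assumes "y \<in> leaves T" "{u, w} \<in> T" "y \<in> side T u w" "{y, w} \<in> E"
  shows "vdeg T u \<le> 2"
proof (rule ccontr)
  assume u: "\<not> vdeg T u \<le> 2"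
  have "\<not> conn (T - {{u, w}}) y w"
    using separated_iff[OF tree assms(3)] side_not[OF tree assms(2)] by metis
  then have "net T (insert {y, w} (T - {{w, u}})) w u y w"
    using net_exchange[OF tree, of w u y w] assms(2,4) by (simp add: insert_commute)
  moreover have "y \<noteq> w" using edgeD[OF assms(4)] by simp
  moreover have "y \<noteq> u" using u assms(1) by (auto simp: leaves_def)
  ultimately show False
    using net_impossible[of _ w u y w] u assms(1) by (auto simp: sink_def)
qed

text \<open>The exchange \<open>- uw + yw\<close> makes \<open>u\<close> a leaf. If its leg ends at \<open>c\<close>, then every branch vertex of
  the new tree has a leg, and the tree is not bad.\<close>

lemma no_parallel_center:
  assumes y: "y \<in> leaves T" and c: "center T c" "card (leaves T) \<le> 6"
    and uw: "{u, w} \<in> T" "y \<in> side T u w" "c \<in> side T u w"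
    and e: "{y, w} \<in> E" "{c, u} \<in> E"
  shows False
proof -
  have sink: "sink c" using c by (simp add: sink_def)
  have cy: "c \<noteq> y" using y c by (auto simp: center_def leaves_def)
  have wu: "{w, u} \<in> T" using uw by (simp add: insert_commute)
  have wV: "w \<in> V" "u \<in> V" "u \<noteq> w" using tree_edgeD[OF tree uw(1)] by auto
  have u2: "vdeg T u \<le> 2" by (rule preceding_degree[OF y uw(1,2) e(1)])
  have uc: "u \<noteq> c" using u2 c by (auto simp: center_def)
  then have u2': "vdeg T u = 2" using leaf_side[OF tree uw(1,3)] u2 by simp
  then have uy: "u \<noteq> y" using y by (auto simp: leaves_def)
  define T1 where "T1 = insert {y, w} (T - {{u, w}})"
  have "\<not> conn (T - {{u, w}}) y w"
    using separated_iff[OF tree uw(2)] side_not[OF tree uw(1)] by metis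
  then have n1: "net T T1 u w y w" unfolding T1_def by (rule net_exchange[OF tree uw(1) e(1)])
  then have tree1: "spanning_tree_edges T1" by (simp add: net_def)
  have deg1: "vdeg T1 v + of_bool (v = u) = vdeg T v + of_bool (v = y)" for v
    using n1[unfolded net_def, THEN conjunct2, THEN spec, of v] by simp
  have L1: "leaves T1 = insert u (leaves T - {y})"
  proof (rule set_eqI)
    fix v
    show "v \<in> leaves T1 \<longleftrightarrow> v \<in> insert u (leaves T - {y})"
      using deg1[of v] u2' y uy wV by (cases "v = u"; cases "v = y") (simp_all add: leaves_def)
  qed
  have B1: "branches T1 = branches T"
  proof -
    have "vdeg T1 v \<ge> 3 \<longleftrightarrow> vdeg T v \<ge> 3" for v
      using deg1[of v] u2' y uy by (auto simp: leaves_def of_bool_def split: if_splits)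
    then show ?thesis by (simp add: branches_def)
  qed
  have "u \<notin> leaves T" using u2' by (simp add: leaves_def)
  then have card1: "card (leaves T1) \<le> 6"
    using L1 c(2) card_Suc_Diff1[OF finite_leaves y] finite_leaves by simp
  have c1: "vdeg T1 c \<ge> 3" using deg1[of c] c(1) uc cy by (simp add: center_def)
  have bad1: "bad T1" by (rule all_bad[OF tree1])
  obtain a b where leg: "leg T1 u a b" using exists_leg[OF tree1 bad1, of u] L1 by auto
  then have ab: "{a, b} \<in> T1" "u \<in> side T1 a b" "vdeg T1 b \<ge> 3" "\<not> branchy T1 a b"
    by (auto simp: leg_def)
  show False
  proof (cases "b = c")
    \<comment> \<open>Trading the last edge of the new leg for \<open>{c, u}\<close> raises
      \<open>c\<close> to degree four without exceeding six leaves.\<close>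
    case False
    have out: "c \<notin> side T1 a b" using ab(4) c1 by (auto simp: branchy_def)
    obtain T2 where "net T1 T2 a b c u" using net_adjacent[OF tree1 ab(1,2) out e(2)] by blast
    then show False
      using net_branch_impossible[OF tree1 _ ab(3) _ card1 c1] L1 out False side_self[of a T1 b]
      by (metis insertI1)
  next
    case True
    \<comment> \<open>The new tree is bad as well and has a center. It is not \<open>c\<close>,
      because the leg of \<open>u\<close> ends there.\<close>
    obtain d where d: "center T1 d" using ex_center[OF tree1 bad1 card1] .
    then have "d \<noteq> c" using ab True by (auto simp: center_def)
    have dB: "d \<in> branches T" "vdeg T d \<ge> 3" using centerD[OF tree1 d] B1 by (auto simp: branches_def)
    \<comment> \<open>This direction at \<open>d\<close> is branch-free in \<open>T\<close> by
      \<open>center_nonbranchy\<close>. As \<open>y\<close> is not in it, the exchange cannot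
      enlarge it, so it stays branch-free in \<open>T1\<close>, which contradicts the choice of
      \<open>d\<close>.\<close>
    obtain n where n: "{n, d} \<in> T" "c \<notin> side T n d" "y \<notin> side T n d"
      using ex_nbr_avoiding[OF tree dB(2)] .
    define M where "M = side T n d"
    have nb: "\<not> branchy T n d"
      by (rule center_nonbranchy[OF tree bad c(2,1) dB(1) \<open>d \<noteq> c\<close> n(1,2)])
    have "\<not> (n = u \<and> d = w)" using n(2) uw(3) by auto
    moreover have "d \<noteq> u" using dB(2) u2' by auto
    ultimately have ne: "{n, d} \<noteq> {u, w}" by (auto simp: doubleton_eq_iff)
    then have nd1: "{n, d} \<in> T1" using n(1) by (simp add: T1_def)
    have inM: "u \<in> M \<longleftrightarrow> w \<in> M"
      using side_leave[OF tree n(1) _ uw(1)] side_leave[OF tree n(1) _ wu] ne unfolding M_def by auto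
    have "side T1 n d \<subseteq> M"
    proof (cases "w \<in> M")
      case False
      show ?thesis
      proof (rule side_subset)
        fix p q assume p: "p \<in> M" and pq: "{p, q} \<in> T1" "{p, q} \<noteq> {n, d}"
        then have "p \<noteq> y" "p \<noteq> w" using n(3) False by (auto simp: M_def)
        then have "{p, q} \<in> T" using pq(1) by (auto simp: T1_def)
        then show "q \<in> M" using side_leave[OF tree n(1)] p pq(2) unfolding M_def by blast
      qed (simp add: M_def)
    next
      \<comment> \<open>The removed edge lies inside \<open>M\<close>, which falls apart. The part
        still attached to \<open>d\<close> is the one on the side of \<open>u\<close>: were
        \<open>n\<close> on the side of \<open>w\<close>, then \<open>c\<close> would be in
        \<open>M\<close>.\<close>
      case wM: True
      have nK: "n \<in> side T u w"
      proof (rule ccontr)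
        assume nK: "n \<notin> side T u w"
        have "c \<in> M \<inter> side T u w"
        proof (rule conn_closed[OF same_side[OF side_self uw(3)]])
          fix p q assume p: "p \<in> M \<inter> side T u w" and pq: "{p, q} \<in> T - {{u, w}}"
          then have "p \<noteq> n" using nK by auto
          then show "q \<in> M \<inter> side T u w"
            using p pq side_leave[OF tree n(1), of p q] side_leave[OF tree uw(1), of p q]
            unfolding M_def by auto
        qed (use wM inM in simp)
        then show False using n(2) by (simp add: M_def)
      qed
      have "side T1 n d \<subseteq> M \<inter> side T u w"
      proof (rule side_subset)
        fix p q assume p: "p \<in> M \<inter> side T u w" and pq: "{p, q} \<in> T1" "{p, q} \<noteq> {n, d}"
        then have "p \<noteq> y" "p \<noteq> w" using n(3) side_not[OF tree uw(1)] by (auto simp: M_def)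
        then have "{p, q} \<in> T" "{p, q} \<noteq> {u, w}" using pq(1) by (auto simp: T1_def)
        then show "q \<in> M \<inter> side T u w"
          using p pq(2) side_leave[OF tree n(1), of p q] side_leave[OF tree uw(1), of p q]
          unfolding M_def by blast
      qed (use nK in \<open>simp add: M_def\<close>)
      then show ?thesis by simp
    qed
    moreover have "\<not> vdeg T1 v \<ge> 3" if v: "v \<in> M" for v
    proof -
      have "v \<noteq> y" using v n(3) by (auto simp: M_def)
      then have "vdeg T1 v \<le> vdeg T v" using deg1[of v] by simp
      then show ?thesis using v nb unfolding branchy_def M_def by auto
    qed
    ultimately have "\<not> branchy T1 n d" unfolding branchy_def by blast
    then show False using d nd1 by (auto simp: center_def)
  qed
qed

text \<open>All six pairs among the neighbours \<open>y\<close>, \<open>s\<close>, \<open>u\<close>,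
  \<open>z\<close> of \<open>w\<close> are non-adjacent. The pairs \<open>y u\<close> and
  \<open>s u\<close> are parallel configurations at \<open>{u, w}\<close>, and \<open>y z\<close>
  and \<open>s z\<close> are such configurations at \<open>{w, z}\<close>, where both sinks lie on
  the side of \<open>w\<close>.\<close>

lemma no_same:
  assumes claw: claw4_free
    and y: "y \<in> leaves T" and s: "sink s" "s \<noteq> y"
    and uw: "{u, w} \<in> T" "y \<in> side T u w" "s \<in> side T u w"
    and e: "{s, w} \<in> E" "{y, w} \<in> E"
  shows False
proof -
  \<comment> \<open>This is \<open>no_parallel\<close> with \<open>y\<close> and \<open>s\<close>
    interchanged, which requires \<open>s\<close> to be a leaf; the center is handled
    separately.\<close>
  have cross: False
    if "{u', w'} \<in> T" "y \<in> side T u' w'" "s \<in> side T u' w'" "{y, w'} \<in> E" "{s, u'} \<in> E" for u' w'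
  proof (cases "s \<in> leaves T")
    case True
    then show ?thesis
      using no_parallel[OF True _ _ that(1,3,2,4,5)] y s(2) by (auto simp: sink_def)
  next
    case False
    then show ?thesis using no_parallel_center[OF y _ _ that] s(1) by (auto simp: sink_def)
  qed
  have wV: "w \<in> V" "u \<in> V" using tree_edgeD[OF tree uw(1)] by auto
  have wu: "{w, u} \<in> T" using uw(1) by (simp add: insert_commute)
  have yw: "y \<noteq> w" using edgeD[OF e(2)] by simp
  have u2: "vdeg T u \<le> 2" by (rule preceding_degree[OF y uw(1,2) e(2)])
  have uy: "u \<noteq> y"
    using leaf_side[OF tree uw(1,3)] s(2) y by (auto simp: leaves_def)
  have us: "u \<noteq> s"
  proof
    assume "u = s"
    then have "\<not> center T s" using u2 by (auto simp: center_def)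
    then show False using s leaf_side[OF tree uw(1,2)] uy \<open>u = s\<close> by (auto simp: sink_def leaves_def)
  qed
  \<comment> \<open>A leaf \<open>w\<close> would be a sink adjacent to \<open>y\<close>. So
    \<open>w\<close> has a second tree neighbour, the fourth end of the claw.\<close>
  have "w \<notin> leaves T"
    using leaf_sink_nonadjacent[OF y, of w] e(2) yw by (auto simp: sink_def insert_commute)
  moreover have "vdeg T w \<ge> 1" using nbrs_le_vdeg[OF tree, of "{u}" w] uw(1) by simp
  ultimately have "vdeg T w \<ge> 2" using wV by (auto simp: leaves_def)
  then obtain z where z: "{w, z} \<in> T" "z \<noteq> u" using ex_other_nbr[OF tree] by metis
  have zw: "{z, w} \<in> T" using z by (simp add: insert_commute)
  have sub: "side T u w \<subseteq> side T w z" using side_nested[OF tree uw(1) z(1)] z(2) by auto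
  have zout: "z \<notin> side T u w" using sub side_not[OF tree z(1)] by auto
  then have "z \<noteq> y" "z \<noteq> s" using uw(2,3) by auto
  then have A: "card {y, s, u, z} = 4" using s(2) uy us z(2) by simp
  have nbr: "\<forall>v\<in>{y, s, u, z}. {v, w} \<in> E" using e uw(1) zw tree_sub[OF tree] by auto
  have 1: "{y, s} \<notin> E" using leaf_sink_nonadjacent[OF y s] by (simp add: insert_commute)
  have 2: "{y, u} \<notin> E" using no_parallel[OF y s uw e(1)] by auto
  have 3: "{s, u} \<notin> E" using cross[OF uw e(2)] by auto
  have 4: "{y, z} \<notin> E"
  proof
    assume yz: "{y, z} \<in> E"
    show False using cross[OF z(1) _ _ yz] sub uw e(1) by blast
  qed
  have 5: "{s, z} \<notin> E"
  proof
    assume sz: "{s, z} \<in> E"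
    show False using no_parallel[OF y s z(1) _ _ sz e(2)] sub uw by blast
  qed
  have 6: "{u, z} \<notin> E" by (rule no_bypass[OF y s uw e z])
  have "\<exists>p\<in>{y, s, u, z}. \<exists>q\<in>{y, s, u, z}. {p, q} \<in> E"
    using claw A nbr unfolding claw4_free_def by blast
  then obtain p q where pq: "p \<in> {y, s, u, z}" "q \<in> {y, s, u, z}" "{p, q} \<in> E" by blast
  moreover have "p \<noteq> q" using edgeD[OF pq(3)] by simp
  ultimately show False
    using 1 2 3 4 5 6 unfolding insert_iff empty_iff
    by (elim disjE) (simp_all add: insert_commute)
qed

section \<open>Counting the edges at the sinks by tree edges\<close>

lemma sum_vdeg_sinks:
  assumes claw: claw4_free and S: "finite S" "\<And>s. s \<in> S \<Longrightarrow> sink s"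
    and center: "\<And>s t. s \<in> S \<Longrightarrow> t \<in> S \<Longrightarrow> s \<noteq> t \<Longrightarrow> s \<in> leaves T \<or> t \<in> leaves T"
  shows "(\<Sum>s\<in>S. card {w. {s, w} \<in> E}) < card V"
proof -
  define D where "D = (SIGMA s:S. {w. {s, w} \<in> E})"
  have "\<exists>u. {u, w} \<in> T \<and> s \<in> side T u w" if "(s, w) \<in> D" for s w
  proof -
    have "w \<in> V" "s \<in> V" "s \<noteq> w" using that edgeD by (auto simp: D_def)
    then show ?thesis using ex_side[OF tree] by metis
  qed
  \<comment> \<open>\<open>g s w\<close> is the vertex before \<open>w\<close> on the tree path from
    \<open>s\<close>.\<close>
  then obtain g where g: "\<And>s w. (s, w) \<in> D \<Longrightarrow> {g s w, w} \<in> T \<and> s \<in> side T (g s w) w" by metis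
  have "inj_on (\<lambda>(s, w). {g s w, w}) D"
  proof (rule inj_onI, clarify)
    fix s w t x assume D: "(s, w) \<in> D" "(t, x) \<in> D" and eq: "{g s w, w} = {g t x, x}"
    have S: "s \<in> S" "t \<in> S" "sink s" "sink t" and E: "{s, w} \<in> E" "{t, x} \<in> E"
      using D S(2) by (auto simp: D_def)
    note gs = g[OF D(1), THEN conjunct1] g[OF D(1), THEN conjunct2]
    \<comment> \<open>At most one element of \<open>S\<close> is not a leaf, so one of two distinct
      sinks can take the role of \<open>y\<close>.\<close>
    note gt = g[OF D(2), THEN conjunct1] g[OF D(2), THEN conjunct2]
    have or: "s \<in> leaves T \<or> t \<in> leaves T" if "s \<noteq> t" using center S that by blast
    show "s = t \<and> w = x"
    proof (cases "w = x")
      case True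
      then have u: "g s w = g t x" using eq by (auto simp: doubleton_eq_iff)
      have "s = t"
      proof (rule ccontr)
        assume "s \<noteq> t"
        then show False
          using or no_same[OF claw _ S(4) _ gs(1,2)] no_same[OF claw _ S(3) _ gt(1,2)]
            gs gt E True u by auto
      qed
      then show ?thesis using True by simp
    next
      \<comment> \<open>The same tree edge is reached from opposite sides.\<close>
      case False
      then have u: "g s w = x" "g t x = w" using eq by (auto simp: doubleton_eq_iff)
      have "s \<in> side T x w" "t \<in> side T w x" "{x, w} \<in> T" "{w, x} \<in> T" using gs gt u by auto
      moreover from this have "s \<noteq> t" using side_disj[OF tree] by metis
      ultimately show ?thesis using or no_opposite[OF _ S(4)] no_opposite[OF _ S(3)] E by metis
    qed
  qed
  moreover have "(\<lambda>(s, w). {g s w, w}) ` D \<subseteq> T" using g by auto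
  ultimately have "card D \<le> card T" using finite_T[OF tree] by (rule card_inj_on_le)
  moreover have "finite {w. {s, w} \<in> E}" for s
    by (rule finite_subset[OF _ finite_V]) (use edgeD in auto)
  then have "card D = (\<Sum>s\<in>S. card {w. {s, w} \<in> E})" unfolding D_def using S(1) by simp
  ultimately show ?thesis using tree by (simp add: spanning_tree_edges_def)
qed

lemma exists_sparse_independent_set:
  assumes claw4_free
  obtains S where "S \<subseteq> V" "card S = 7" "indep S" "(\<Sum>s\<in>S. card {w. {s, w} \<in> E}) < card V"
proof -
  have "\<exists>S. card S = 7 \<and> (\<forall>s\<in>S. sink s) \<and> (\<forall>s\<in>S. \<forall>t\<in>S. s \<noteq> t \<longrightarrow> s \<in> leaves T \<or> t \<in> leaves T)"
  proof (cases "card (leaves T) \<ge> 7")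
    case True
    then obtain S where "S \<subseteq> leaves T" "card S = 7" by (meson obtain_subset_with_card_n)
    then show ?thesis by (intro exI[of _ S]) (auto simp: sink_def)
  next
    case False
    then have 6: "card (leaves T) \<le> 6" "card (leaves T) = 6" using bad_leaves(1)[OF tree bad] by auto
    obtain c where c: "center T c" using ex_center[OF tree bad 6(1)] .
    then have "c \<notin> leaves T" by (auto simp: center_def leaves_def)
    then have "card (insert c (leaves T)) = 7" using 6 finite_leaves by simp
    then show ?thesis using c 6 by (intro exI[of _ "insert c (leaves T)"]) (auto simp: sink_def)
  qed
  then obtain S where S: "card S = 7" "\<And>s. s \<in> S \<Longrightarrow> sink s"
    "\<And>s t. s \<in> S \<Longrightarrow> t \<in> S \<Longrightarrow> s \<noteq> t \<Longrightarrow> s \<in> leaves T \<or> t \<in> leaves T" by metis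
  have "finite S" using S(1) by (simp add: card_ge_0_finite)
  moreover have "indep S"
    unfolding indep_def
  proof (intro ballI)
    fix s t assume st: "s \<in> S" "t \<in> S"
    show "{s, t} \<notin> E"
    proof (cases "s = t")
      case True
      then show ?thesis using edgeD by blast
    next
      case False
      then show ?thesis
        using S(3)[OF st] leaf_sink_nonadjacent[of s t] leaf_sink_nonadjacent[of t s] S(2) st
        by (metis insert_commute)
    qed
  qed
  moreover have "S \<subseteq> V" using S(2) sink_V by blast
  moreover have "(\<Sum>s\<in>S. card {w. {s, w} \<in> E}) < card V"
    using sum_vdeg_sinks[OF assms \<open>finite S\<close>] S(2,3) by blast
  ultimately show ?thesis using that S(1) by blast
qed

end

end

theorem exists_good_tree:
  assumes "V \<noteq> {}" "\<And>x y. x \<in> V \<Longrightarrow> y \<in> V \<Longrightarrow> conn E x y" "claw4_free"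
    and dense: "\<And>S. S \<subseteq> V \<Longrightarrow> card S = 7 \<Longrightarrow> indep S \<Longrightarrow> card V \<le> (\<Sum>s\<in>S. card {w. {s, w} \<in> E})"
  obtains T where "spanning_tree_edges T" "\<not> bad T"
proof (cases "\<exists>T. spanning_tree_edges T \<and> \<not> bad T")
  case False
  then have all_bad: "\<And>T. spanning_tree_edges T \<Longrightarrow> bad T" by blast
  obtain T0 where "spanning_tree_edges T0" using ex_spanning_tree[OF assms(1,2)] .
  then obtain T where T: "spanning_tree_edges T"
    "\<And>T'. spanning_tree_edges T' \<Longrightarrow> card (leaves T) \<le> card (leaves T')"
    using ex_has_least_nat[of spanning_tree_edges T0 "\<lambda>T. card (leaves T)"] by blast
  obtain S where "S \<subseteq> V" "card S = 7" "indep S" "(\<Sum>s\<in>S. card {w. {s, w} \<in> E}) < card V"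
    by (rule exists_sparse_independent_set[OF all_bad T assms(3)])
  then show ?thesis using dense[of S] by simp
qed (use that in blast)

end

section \<open>Reducible stems that are paths\<close>

definition path_in :: "'a set set \<Rightarrow> 'a list \<Rightarrow> bool" where
  "path_in T xs \<longleftrightarrow> xs \<noteq> [] \<and> distinct xs \<and> successively (\<lambda>a b. {a, b} \<in> T) xs"

lemma successively_rev_edges:
  "successively (\<lambda>a b. {a, b} \<in> T) (rev xs) \<longleftrightarrow> successively (\<lambda>a b. {a, b} \<in> T) xs"
  by (simp add: insert_commute)

lemma successively_exit:
  assumes "successively (\<lambda>a b. {a, b} \<in> T) xs" "xs \<noteq> []" "hd xs \<in> M" "last xs \<notin> M"
  shows "\<exists>p\<in>set xs. \<exists>q\<in>set xs. p \<in> M \<and> q \<notin> M \<and> {p, q} \<in> T"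
  using assms
proof (induction xs)
  case (Cons x xs)
  show ?case
  proof (cases xs)
    case Nil
    then show ?thesis using Cons by simp
  next
    case (Cons y ys)
    then show ?thesis using Cons.IH Cons.prems by (cases "y \<in> M") auto
  qed
qed simp

lemma conn_path_in:
  assumes "conn T u v"
  shows "\<exists>xs. path_in T xs \<and> hd xs = u \<and> last xs = v"
  using assms unfolding conn_def
proof (induction rule: rtranclp_induct)
  case base
  show ?case by (intro exI[of _ "[u]"]) (simp add: path_in_def)
next
  case (step y z)
  then obtain xs where xs: "path_in T xs" "hd xs = u" "last xs = y" by blast
  show ?case
  proof (cases "z \<in> set xs")
    case True
    then obtain ys zs where eq: "xs = ys @ z # zs" by (meson split_list)
    then have "path_in T (ys @ [z])"
      using xs(1) unfolding path_in_def by (auto simp: successively_append_iff)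
    moreover have "hd (ys @ [z]) = u" using xs(2) eq by (cases ys) auto
    ultimately show ?thesis by (intro exI[of _ "ys @ [z]"]) simp
  next
    case False
    then have "path_in T (xs @ [z])"
      using xs step(2) unfolding path_in_def by (auto simp: successively_append_iff)
    moreover have "hd (xs @ [z]) = u" using xs unfolding path_in_def by simp
    ultimately show ?thesis by (intro exI[of _ "xs @ [z]"]) simp
  qed
qed

lemma path_in_conn:
  assumes "successively (\<lambda>a b. {a, b} \<in> T) xs" "xs \<noteq> []"
  shows "conn T (hd xs) (last xs)"
  using assms
proof (induction xs)
  case (Cons x xs)
  show ?case
  proof (cases xs)
    case (Cons y ys)
    then show ?thesis using Cons.IH Cons.prems conn_trans[OF conn_edge] by fastforce
  qed simp
qed simp

context edge_graph
begin

context
  fixes T assumes tree: "spanning_tree_edges T"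
begin

text \<open>A path with at least three vertices does not use the edge joining its ends, so that edge
  would not be a bridge.\<close>

lemma no_cycle:
  assumes xs: "path_in T xs" "length xs \<ge> 3" shows "{hd xs, last xs} \<notin> T"
proof
  assume e: "{hd xs, last xs} \<in> T"
  have "successively (\<lambda>a b. {a, b} \<in> T - {{hd xs, last xs}}) xs"
    unfolding successively_conv_nth
  proof (intro allI impI)
    fix i assume i: "Suc i < length xs"
    have d: "distinct xs" using xs(1) by (simp add: path_in_def)
    have ne: "xs \<noteq> []" using xs(2) by auto
    have "{xs ! i, xs ! Suc i} \<noteq> {xs ! 0, xs ! (length xs - 1)}"
      using i xs(2) nth_eq_iff_index_eq[OF d] unfolding doubleton_eq_iff
      by (metis One_nat_def Suc_lessD Suc_pred diff_Suc_1 diff_Suc_less length_greater_0_conv ne less_numeral_extra(3) nat.simps(3) not_less_eq_eq numeral_3_eq_3 order_refl zero_less_Suc)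
    then show "{xs ! i, xs ! Suc i} \<in> T - {{hd xs, last xs}}"
      using xs(1) i ne unfolding path_in_def successively_conv_nth
      by (simp add: hd_conv_nth last_conv_nth)
  qed
  then have "conn (T - {{hd xs, last xs}}) (hd xs) (last xs)"
    using path_in_conn xs(1) unfolding path_in_def by blast
  then show False using bridge[OF tree e] by simp
qed

text \<open>A longest path in \<open>R\<close> covers \<open>R\<close>.\<close>

lemma convex_path:
  assumes R: "R \<subseteq> V" "R \<noteq> {}"
    and convex: "\<And>xs. path_in T xs \<Longrightarrow> hd xs \<in> R \<Longrightarrow> last xs \<in> R \<Longrightarrow> set xs \<subseteq> R"
    and deg: "\<And>c N. c \<in> R \<Longrightarrow> N \<subseteq> R \<Longrightarrow> \<forall>n\<in>N. {n, c} \<in> T \<Longrightarrow> card N \<noteq> 3"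
  obtains vs where "vs \<noteq> []" "distinct vs" "R = set vs"
    "\<And>i j. i < length vs \<Longrightarrow> j < length vs \<Longrightarrow> {vs ! i, vs ! j} \<in> T \<longleftrightarrow> j = Suc i \<or> i = Suc j"
proof -
  define P where "P xs \<longleftrightarrow> path_in T xs \<and> set xs \<subseteq> R" for xs
  obtain r where "r \<in> R" using R(2) by blast
  then have "P [r]" by (simp add: P_def path_in_def)
  moreover have "\<forall>xs. P xs \<longrightarrow> length xs < Suc (card R)"
    unfolding P_def path_in_def using card_mono[OF finite_subset[OF R(1) finite_V]]
    by (metis distinct_card less_Suc_eq_le)
  ultimately obtain vs where vs: "P vs" and max: "\<And>xs. P xs \<Longrightarrow> length xs \<le> length vs"
    using ex_has_greatest_nat[of P "[r]" length] by blast
  have path: "path_in T vs" "set vs \<subseteq> R" using vs by (auto simp: P_def)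
  have d: "distinct vs" and ne: "vs \<noteq> []"
    and suc: "\<And>i. Suc i < length vs \<Longrightarrow> {vs ! i, vs ! Suc i} \<in> T"
    using path(1) by (auto simp: path_in_def successively_conv_nth)
  have "R \<subseteq> set vs"
  proof (rule ccontr)
    assume "\<not> R \<subseteq> set vs"
    then obtain r where r: "r \<in> R" "r \<notin> set vs" by blast
    have hd: "hd vs \<in> R" using path(2) ne by auto
    \<comment> \<open>By convexity the tree path to an uncovered \<open>r\<close> stays in
      \<open>R\<close>. Where it leaves the list, the new vertex \<open>q\<close> either prolongs
      the list at one end or is a third neighbour of an inner vertex.\<close>
    then obtain xs where xs: "path_in T xs" "hd xs = hd vs" "last xs = r"
      using conn_path_in[OF tree_conn[OF tree]] r(1) R(1) by (metis subsetD)
    have xsR: "set xs \<subseteq> R" using convex[OF xs(1)] xs hd r by simp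
    obtain p q where pq: "p \<in> set xs" "q \<in> set xs" "p \<in> set vs" "q \<notin> set vs" "{p, q} \<in> T"
      using successively_exit[of T xs "set vs"] xs r(2) ne unfolding path_in_def by auto
    have qR: "q \<in> R" using pq xsR by blast
    obtain i where i: "i < length vs" "p = vs ! i" using pq(3) by (auto simp: in_set_conv_nth)
    consider "i = 0" | "Suc i = length vs" | "i > 0" "Suc i < length vs" using i(1) by linarith
    then show False
    proof cases
      case 1
      then have "{q, hd vs} \<in> T" using pq(5) i ne by (simp add: hd_conv_nth insert_commute)
      then have "P (q # vs)"
        using vs qR pq(4) ne unfolding P_def path_in_def by (simp add: successively_Cons)
      then show False using max by fastforce
    next
      case 2
      then have "{last vs, q} \<in> T" using pq(5) i ne by (metis diff_Suc_1 last_conv_nth)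
      then have "P (vs @ [q])"
        using vs qR pq(4) ne unfolding P_def path_in_def by (simp add: successively_append_iff)
      then show False using max by fastforce
    next
      case 3
      define N where "N = {vs ! (i - 1), vs ! Suc i, q}"
      have "vs ! (i - 1) \<noteq> vs ! Suc i" using d 3 by (simp add: nth_eq_iff_index_eq)
      moreover have "vs ! (i - 1) \<noteq> q" "vs ! Suc i \<noteq> q" using pq(4) 3 i(1) by auto
      ultimately have "card N = 3" by (simp add: N_def)
      moreover have "N \<subseteq> R" using path(2) qR 3 by (auto simp: N_def)
      moreover have "\<forall>n\<in>N. {n, p} \<in> T"
        using suc[of "i - 1"] suc[of i] 3 i pq(5) by (auto simp: N_def insert_commute)
      ultimately show False using deg[of p N] pq(3) path(2) by blast
    qed
  qed
  then have R_eq: "R = set vs" using path(2) by blast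
  \<comment> \<open>A chord would close a cycle with the segment of the list between its
    ends.\<close>
  have no_chord: "j = Suc i" if ij: "i < j" "j < length vs" "{vs ! i, vs ! j} \<in> T" for i j
  proof (rule ccontr)
    assume "j \<noteq> Suc i"
    define xs where "xs = take (j - i + 1) (drop i vs)"
    have len: "length xs = j - i + 1" using ij by (simp add: xs_def)
    have nth: "xs ! k = vs ! (i + k)" if "k \<le> j - i" for k using that ij by (simp add: xs_def)
    have "distinct xs" using d by (simp add: xs_def)
    moreover have "successively (\<lambda>a b. {a, b} \<in> T) xs"
      unfolding successively_conv_nth using len nth suc ij(2) by simp
    ultimately have "path_in T xs" using len by (auto simp: path_in_def)
    moreover have "length xs \<ge> 3" using len ij(1) \<open>j \<noteq> Suc i\<close> by simp
    moreover have "hd xs = vs ! i" "last xs = vs ! j"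
      using nth[of 0] nth[of "j - i"] len ij(1)
      by (simp_all add: hd_conv_nth last_conv_nth flip: length_greater_0_conv)
    ultimately show False using no_cycle[of xs] ij(3) by simp
  qed
  have "{vs ! i, vs ! j} \<in> T \<longleftrightarrow> j = Suc i \<or> i = Suc j" if ij: "i < length vs" "j < length vs" for i j
  proof
    assume e: "{vs ! i, vs ! j} \<in> T"
    then have "i \<noteq> j" using tree_edgeD[OF tree] by blast
    then consider "i < j" | "j < i" by linarith
    then show "j = Suc i \<or> i = Suc j"
    proof cases
      case 1
      then show ?thesis using no_chord[OF _ ij(2) e] by simp
    next
      case 2
      then show ?thesis using no_chord[OF _ ij(1)] e by (simp add: insert_commute)
    qed
  next
    assume "j = Suc i \<or> i = Suc j"
    then show "{vs ! i, vs ! j} \<in> T" using suc[of i] suc[of j] ij by (auto simp: insert_commute)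
  qed
  then show ?thesis using that[OF ne d R_eq] by blast
qed

text \<open>The vertex set of the reducible stem, with the deleted leaf-branch paths described as
  branch-free sides at a branch vertex. Without branch vertices it is all of
  \<open>V\<close>.\<close>

definition stem :: "'a set" where
  "stem = {v \<in> V. \<forall>a b. {a, b} \<in> T \<and> vdeg T b \<ge> 3 \<and> \<not> branchy T a b \<longrightarrow> v \<notin> side T a b}"

lemma branches_stem: "branches T \<subseteq> stem"
  by (auto simp: branches_def stem_def branchy_def)

text \<open>A leg side can only be left through \<open>b\<close>. A path with both ends outside and
  a vertex \<open>t\<close> inside would pass \<open>b\<close> before and after
  \<open>t\<close>.\<close>

lemma stem_convex:
  assumes xs: "path_in T xs" "hd xs \<in> stem" "last xs \<in> stem"
  shows "set xs \<subseteq> stem"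
proof
  fix t assume t: "t \<in> set xs"
  have d: "distinct xs" and suc: "successively (\<lambda>a b. {a, b} \<in> T) xs"
    using xs(1) by (auto simp: path_in_def)
  obtain ys zs where eq: "xs = ys @ t # zs" using t by (meson split_list)
  have tV: "t \<in> V"
  proof -
    have "conn T t (last xs)"
      using path_in_conn[of T "t # zs"] suc eq by (auto simp: successively_append_iff)
    then have "conn T (last xs) t" by (rule conn_sym)
    then show ?thesis
      by (rule conn_closed[of _ _ _ V]) (use xs(3) tree_edgeD[OF tree] in \<open>auto simp: stem_def\<close>)
  qed
  have "t \<notin> side T a b" if ab: "{a, b} \<in> T" "vdeg T b \<ge> 3" "\<not> branchy T a b" for a b
  proof
    assume tA: "t \<in> side T a b"
    have out: "hd xs \<notin> side T a b" "last xs \<notin> side T a b"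
      using xs(2,3) ab by (auto simp: stem_def)
    have exit: "b \<in> set l" if "set l \<subseteq> set xs" "l \<noteq> []" "hd l = t" "last l \<notin> side T a b"
      "successively (\<lambda>a b. {a, b} \<in> T) l" for l
      using successively_exit[OF that(5,2), of "side T a b"] that(3,4) tA side_leave[OF tree ab(1)]
      by metis
    have "b \<in> set (t # zs)"
      by (rule exit) (use out suc eq in \<open>auto simp: successively_append_iff\<close>)
    moreover have "b \<in> set (rev (ys @ [t]))"
    proof (rule exit)
      show "last (rev (ys @ [t])) \<notin> side T a b" using out(1) eq by (cases ys) auto
      have "successively (\<lambda>a b. {a, b} \<in> T) (ys @ [t])"
        using suc eq by (auto simp: successively_append_iff)
      then show "successively (\<lambda>a b. {a, b} \<in> T) (rev (ys @ [t]))"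
        unfolding successively_rev_edges .
    qed (use eq in auto)
    moreover have "b \<noteq> t" using side_not[OF tree ab(1)] tA by auto
    ultimately show False using d eq by auto
  qed
  then show "t \<in> stem" using tV by (simp add: stem_def)
qed

text \<open>This turns three stem neighbours of a stem vertex into three branchy directions, as in
  \<open>bad\<close>. If \<open>side T n c\<close> were branch-free, \<open>c\<close> would have
  degree below three, as otherwise \<open>n\<close> is deleted; so the branch-free part extends over
  \<open>c\<close>. The leg of a leaf in it has to run through \<open>c\<close>, which would then be
  deleted too.\<close>

lemma stem_branchy:
  assumes nonempty: "branches T \<noteq> {}" and c: "c \<in> stem" and n: "n \<in> stem" "{n, c} \<in> T"
  shows "branchy T n c"
proof (rule ccontr)
  assume nb: "\<not> branchy T n c"
  obtain v where v: "v \<in> V" "vdeg T v \<ge> 3" using nonempty by (auto simp: branches_def)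
  have c3: "vdeg T c < 3" using n nb by (force simp: stem_def)
  have cn: "{c, n} \<in> T" using n(2) by (simp add: insert_commute)
  have "v \<noteq> c" using v(2) c3 by auto
  moreover have "v \<in> side T c n" using side_cover[OF tree n(2) v(1)] nb v(2) by (auto simp: branchy_def)
  ultimately obtain m where m: "{m, c} \<in> T" "m \<noteq> n" "v \<in> side T m c"
    using side_decomp[OF tree cn] by metis
  have cm: "{c, m} \<in> T" using m(1) by (simp add: insert_commute)
  have "u = c \<or> u \<in> side T n c" if u: "u \<in> side T c m" for u
  proof (rule ccontr)
    assume "\<not> ?thesis"
    then obtain k where k: "{k, c} \<in> T" "k \<noteq> m" "u \<in> side T k c" "u \<notin> side T n c"
      using side_decomp[OF tree cm u] by metis
    then have "k \<noteq> n" by auto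
    moreover have "\<And>x. x \<in> {k, m, n} \<Longrightarrow> {x, c} \<in> T" using k m n by auto
    then have "card {k, m, n} \<le> vdeg T c" by (rule nbrs_le_vdeg[OF tree])
    ultimately show False using c3 k(2) m(2) by simp
  qed
  then have nb': "\<not> branchy T c m" using nb c3 by (force simp: branchy_def)
  obtain x where x: "x \<in> side T c m" "x \<in> leaves T" using ex_leaf_side[OF tree cm] by blast
  obtain a b where ab: "{a, b} \<in> T" "x \<in> side T a b" "vdeg T b \<ge> 3" "\<not> branchy T a b"
    using ex_leg[OF tree x(2) nonempty] .
  have cA: "c \<notin> side T a b" using c ab by (auto simp: stem_def)
  have bM: "b \<notin> side T c m" using nb' ab(3) by (auto simp: branchy_def)
  have "b \<in> side T a b \<inter> side T c m"
  proof (rule conn_closed)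
    show "conn T x b" using tree_conn[OF tree] side_sub[OF tree ab(1)] ab(2) tree_edgeD[OF tree ab(1)] by blast
    fix p q assume p: "p \<in> side T a b \<inter> side T c m" and pq: "{p, q} \<in> T"
    then have "p \<noteq> c" using cA by auto
    then have "q \<in> side T c m" using side_leave[OF tree cm _ pq] p by auto
    then show "q \<in> side T a b \<inter> side T c m" using side_leave[OF tree ab(1) _ pq] p bM by auto
  qed (use x ab in auto)
  then show False using bM by simp
qed

lemma stem_path:
  assumes "\<not> bad T" "branches T \<noteq> {}"
  obtains vs where "vs \<noteq> []" "distinct vs" "stem = set vs"
    "\<And>i j. i < length vs \<Longrightarrow> j < length vs \<Longrightarrow> {vs ! i, vs ! j} \<in> T \<longleftrightarrow> j = Suc i \<or> i = Suc j"
proof (rule convex_path[of stem])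
  show "stem \<subseteq> V" by (auto simp: stem_def)
  show "stem \<noteq> {}" using branches_stem assms(2) by auto
  show "set xs \<subseteq> stem" if "path_in T xs" "hd xs \<in> stem" "last xs \<in> stem" for xs
    by (rule stem_convex[OF that])
  show "card N \<noteq> 3" if "c \<in> stem" "N \<subseteq> stem" "\<forall>n\<in>N. {n, c} \<in> T" for c N
    using assms(1) stem_branchy[OF assms(2) that(1)] that unfolding bad_def by blast
qed (use that in blast)

lemma tree_path:
  assumes "V \<noteq> {}" "branches T = {}"
  obtains vs where "vs \<noteq> []" "distinct vs" "V = set vs"
    "\<And>i j. i < length vs \<Longrightarrow> j < length vs \<Longrightarrow> {vs ! i, vs ! j} \<in> T \<longleftrightarrow> j = Suc i \<or> i = Suc j"
proof (rule convex_path[of V])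
  show "set xs \<subseteq> V" if "path_in T xs" "hd xs \<in> V" "last xs \<in> V" for xs
  proof
    fix t assume "t \<in> set xs"
    then obtain ys zs where eq: "xs = ys @ t # zs" by (meson split_list)
    have "conn T t (last xs)"
      using path_in_conn[of T "t # zs"] that(1) eq by (auto simp: path_in_def successively_append_iff)
    then have "conn T (last xs) t" by (rule conn_sym)
    then show "t \<in> V"
      by (rule conn_closed[of _ _ _ V]) (use that(3) tree_edgeD[OF tree] in auto)
  qed
  show "card N \<noteq> 3" if "c \<in> V" "N \<subseteq> V" "\<forall>n\<in>N. {n, c} \<in> T" for c N
    using nbrs_le_vdeg[OF tree, of N c] that assms(2) by (force simp: branches_def)
qed (use assms that in blast)+

text \<open>The leg side can only be left through \<open>b\<close>, so the path ends there. It
  misses no vertex \<open>v\<close> of the side because \<open>v\<close> separates \<open>x\<close>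
  from \<open>b\<close>: otherwise another direction at \<open>v\<close> would remain inside the
  side and contain a second leaf.\<close>

lemma leg_path:
  assumes leg: "leg T x a b" and x: "x \<in> leaves T"
    and xs: "path_in T xs" "hd xs = x" "last xs = y" "vdeg T y \<ge> 3"
    and shortest: "\<And>z. z \<in> set xs \<Longrightarrow> vdeg T z \<ge> 3 \<Longrightarrow> z = y"
  shows "set xs - {y} = side T a b"
proof -
  have ab: "{a, b} \<in> T" "x \<in> side T a b" "vdeg T b \<ge> 3" "\<not> branchy T a b"
    using leg by (auto simp: leg_def)
  have d: "distinct xs" and suc: "successively (\<lambda>a b. {a, b} \<in> T) xs" and ne: "xs \<noteq> []"
    using xs(1) by (auto simp: path_in_def)
  have exit: "\<exists>p\<in>set l. \<exists>q\<in>set l. p \<in> M \<and> q \<notin> M \<and> {p, q} \<in> T"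
    if "xs = l @ l'" "l \<noteq> []" "x \<in> M" "last l \<notin> M" for l l' M
    using successively_exit[of T l M] suc xs(2) that by (auto simp: successively_append_iff)
  have yA: "y \<notin> side T a b" using ab(4) xs(4) by (auto simp: branchy_def)
  then have "b \<in> set xs"
    using exit[of xs "[]" "side T a b"] ne ab(2) xs(3) side_leave[OF tree ab(1)] by auto
  then have yb: "y = b" using shortest ab(3) by blast
  have "v \<in> side T a b" if v: "v \<in> set xs" "v \<noteq> y" for v
  proof (rule ccontr)
    assume vA: "v \<notin> side T a b"
    obtain ys zs where eq: "xs = ys @ v # zs" using v(1) by (meson split_list)
    then have "b \<in> set (ys @ [v])"
      using exit[of "ys @ [v]" zs "side T a b"] ab(2) vA side_leave[OF tree ab(1)] by auto
    moreover have "b \<in> set zs" using eq xs(3) v(2) yb by (auto split: if_splits)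
    ultimately show False using d eq v(2) yb by auto
  qed
  moreover have "v \<in> set xs" if v: "v \<in> side T a b" for v
  proof (cases "v = x")
    case False
    have bv: "b \<noteq> v" using side_not[OF tree ab(1)] v by auto
    have vV: "v \<in> V" "x \<in> V" "b \<in> V"
      using side_sub[OF tree ab(1)] v ab(2) tree_edgeD[OF tree ab(1)] by auto
    obtain n where n: "{n, v} \<in> T" "x \<in> side T n v" using ex_side[OF tree vV(1,2)] False by metis
    have "b \<notin> side T n v"
    proof
      assume bn: "b \<in> side T n v"
      have "v \<notin> leaves T" using unique_leaf_side[OF tree ab(1,4) v _ ab(2) x] False by blast
      moreover have "vdeg T v \<ge> 1" using nbrs_le_vdeg[OF tree, of "{n}" v] n(1) by simp
      ultimately have "vdeg T v \<ge> 2" using vV(1) by (auto simp: leaves_def)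
      then obtain k where k: "{v, k} \<in> T" "k \<noteq> n" using ex_other_nbr[OF tree] by metis
      then have kv: "{k, v} \<in> T" by (simp add: insert_commute)
      have bk: "b \<notin> side T k v" using side_unique[OF tree kv n(1)] bn k(2) by blast
      then have "k \<in> side T a b"
        using side_leave[OF tree ab(1) v k(1)] side_self[of k T v] by metis
      then have "side T k v \<subseteq> side T k v \<inter> side T a b"
        using side_leave[OF tree kv] side_leave[OF tree ab(1)] bk bv
        by (intro side_subset) (auto, metis+)
      moreover obtain z where "z \<in> side T k v" "z \<in> leaves T" using ex_leaf_side[OF tree kv] by blast
      ultimately have "x \<in> side T k v" using unique_leaf_side[OF tree ab(1,4) _ _ ab(2) x, of z] by blast
      then show False using side_unique[OF tree kv n(1) _ n(2)] k(2) by blast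
    qed
    then show ?thesis
      using exit[of xs "[]" "side T n v"] ne n(2) xs(3) yb side_leave[OF tree n(1)] by auto
  qed (use xs ne in auto)
  ultimately show ?thesis using yA by blast
qed

end

end

section \<open>From edge sets to symmetric digraphs\<close>

definition edge_set :: "('a, 'b) pre_digraph \<Rightarrow> 'a set set" where
  "edge_set G = {{a, b} | a b. a \<rightarrow>\<^bsub>G\<^esub> b}"

lemma edge_set_iff:
  assumes "graph G" shows "{a, b} \<in> edge_set G \<longleftrightarrow> a \<rightarrow>\<^bsub>G\<^esub> b"
proof -
  interpret graph G by fact
  show ?thesis
    unfolding edge_set_def using graph_symmetric by (auto simp: doubleton_eq_iff)
qed

lemma edge_graph_edge_set:
  assumes "graph G" shows "edge_graph (verts G) (edge_set G)"
proof -
  interpret graph G by fact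
  show ?thesis
  proof
    fix e assume "e \<in> edge_set G"
    then obtain a b where "e = {a, b}" "a \<rightarrow>\<^bsub>G\<^esub> b" by (auto simp: edge_set_def)
    then show "e \<subseteq> verts G \<and> card e = 2"
      using adj_in_verts adj_not_same by (cases "a = b") auto
  qed simp
qed

lemma deg_edge_set:
  assumes "graph G" shows "deg G v = card {w. {v, w} \<in> edge_set G}"
proof -
  interpret graph G by fact
  have "bij_betw (head G) (out_arcs G v) {w. v \<rightarrow>\<^bsub>G\<^esub> w}"
    unfolding bij_betw_def
  proof
    show "inj_on (head G) (out_arcs G v)"
      by (rule inj_onI) (rule no_multi_arcs, auto simp: arc_to_ends_def)
    show "head G ` out_arcs G v = {w. v \<rightarrow>\<^bsub>G\<^esub> w}"
      by (auto simp: arcs_ends_conv)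
  qed
  then show ?thesis
    unfolding out_degree_def edge_set_iff[OF assms] by (rule bij_betw_same_card)
qed

lemma connected_edge_set:
  assumes "graph G"
  shows "connected G \<longleftrightarrow> verts G \<noteq> {} \<and> (\<forall>u\<in>verts G. \<forall>v\<in>verts G. conn (edge_set G) u v)"
proof -
  interpret graph G by fact
  have "u \<rightarrow>\<^sup>*\<^bsub>mk_symmetric G\<^esub> v \<longleftrightarrow> conn (edge_set G) u v" if "u \<in> verts G" for u v
    unfolding reachable_mk_symmetric_eq[OF sym_arcs] reachable_conv'[OF that] conn_def
      edge_set_iff[OF assms] by (simp add: rtranclp_rtrancl_eq)
  then show ?thesis unfolding connected_def strongly_connected_def by simp
qed

lemma arcs_ends_induce: "arcs_ends (G \<restriction> S) = {(u, v) \<in> arcs_ends G. u \<in> S \<and> v \<in> S}"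
  by (auto simp: arcs_ends_conv)

lemma graph_induce:
  assumes "graph G" "S \<subseteq> verts G" shows "graph (G \<restriction> S)"
proof -
  interpret graph G by fact
  interpret D: digraph "G \<restriction> S" by (rule digraphI_induced[OF induced_induce[OF assms(2)]])
  show ?thesis
    by (rule D.graphI)
      (use graph_symmetric in \<open>auto intro!: symI simp: symmetric_def arcs_ends_induce\<close>)
qed

text \<open>A counterexample \<open>A\<close> is independent and completely joined to
  \<open>w\<close>, so \<open>insert w A\<close> induces the star.\<close>

lemma K14_free_claw4_free:
  assumes G: "graph G" and free: "K14_free G"
  shows "edge_graph.claw4_free (edge_set G)"
proof -
  interpret graph G by fact
  interpret E: edge_graph "verts G" "edge_set G" by (rule edge_graph_edge_set[OF G])
  show ?thesis
    unfolding E.claw4_free_def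
  proof (intro allI impI, rule ccontr)
    fix w A
    assume A: "card A = 4" "\<forall>a\<in>A. {a, w} \<in> edge_set G"
      and "\<not> (\<exists>a\<in>A. \<exists>b\<in>A. {a, b} \<in> edge_set G)"
    then have indep: "\<And>a b. a \<in> A \<Longrightarrow> b \<in> A \<Longrightarrow> \<not> a \<rightarrow>\<^bsub>G\<^esub> b"
      by (simp add: edge_set_iff[OF G])
    have adj: "a \<rightarrow>\<^bsub>G\<^esub> w" "w \<rightarrow>\<^bsub>G\<^esub> a" if "a \<in> A" for a
      using A(2) that graph_symmetric by (auto simp: edge_set_iff[OF G])
    have "A \<noteq> {}" using A(1) by auto
    then have sub: "insert w A \<subseteq> verts G" using adj adj_in_verts by blast
    have wA: "w \<notin> A" using indep adj by blast
    have "\<not> w \<rightarrow>\<^bsub>G\<^esub> w" using adj_not_same by blast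
    then have "arcs_ends (G \<restriction> insert w A) = {w} \<times> A \<union> A \<times> {w}"
      unfolding arcs_ends_induce using indep adj by blast
    moreover have "verts (G \<restriction> insert w A) = {w} \<union> A" by simp
    moreover have "{w} \<inter> A = {}" "card {w} = 1" using wA by auto
    ultimately have "K\<^bsub>1,4\<^esub> (G \<restriction> insert w A)"
      unfolding complete_bipartite_digraph_def using graph_induce[OF G sub] A(1) by blast
    then show False using free induced_induce[OF sub] unfolding K14_free_def by blast
  qed
qed

lemma awalk_successively:
  assumes "graph H" "pre_digraph.awalk H u p v"
  shows "successively (\<lambda>a b. {a, b} \<in> edge_set H) (pre_digraph.awalk_verts H u p)"
proof -
  interpret graph H by fact
  show ?thesis
    using assms(2)
  proof (induction p arbitrary: u)
    case (Cons e p)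
    then have e: "e \<in> arcs H" "tail H e = u" "awalk (head H e) p v"
      by (auto simp: awalk_Cons_iff)
    then have "{u, head H e} \<in> edge_set H"
      unfolding edge_set_iff[OF assms(1)] by (auto simp: arcs_ends_conv)
    moreover have "hd (awalk_verts (head H e) p) = head H e" using e(3) by auto
    ultimately show ?case using Cons.IH[OF e(3)] e(2) by (simp add: successively_Cons)
  qed simp
qed

lemma apath_path_in:
  assumes "graph H" "pre_digraph.apath H u p v"
  shows "path_in (edge_set H) (pre_digraph.awalk_verts H u p)"
    "hd (pre_digraph.awalk_verts H u p) = u" "last (pre_digraph.awalk_verts H u p) = v"
proof -
  interpret graph H by fact
  show "path_in (edge_set H) (awalk_verts u p)" "awhd u p = u" "awlast u p = v"
    using assms(2) awalk_successively[OF assms(1), of u p v] by (auto simp: apath_def path_in_def)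
qed

text \<open>A cycle of length at least three visits its vertices, read off from the second one, along a
  path whose ends are adjacent.\<close>

lemma undirected_tree_edge_set:
  assumes H: "graph H" and tree: "edge_graph.spanning_tree_edges V E (edge_set H)"
    and V: "edge_graph V E" "verts H = V" "V \<noteq> {}"
  shows "undirected_tree H"
proof -
  interpret graph H by fact
  interpret E: edge_graph V E by fact
  have "connected H"
    unfolding connected_edge_set[OF H] using V E.tree_conn[OF tree] by simp
  moreover have False if c: "cycle c" "3 \<le> length c" for c
  proof -
    obtain u where u: "awalk u c u" "distinct (tl (awalk_verts u c))"
      using c(1) by (auto simp: cycle_def)
    obtain e p where ep: "c = e # p" using c(2) by (cases c) auto
    have e: "e \<in> arcs H" "tail H e = u" "awalk (head H e) p u"
      using u(1) ep by (auto simp: awalk_Cons_iff)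
    define xs where "xs = awalk_verts (head H e) p"
    have "path_in (edge_set H) xs"
      using awalk_successively[OF H e(3)] u(2) ep by (simp add: path_in_def xs_def)
    moreover have "length xs \<ge> 3" using c(2) ep by (simp add: xs_def length_awalk_verts)
    moreover have "hd xs = head H e" "last xs = u" using e(3) by (auto simp: xs_def)
    moreover have "{head H e, u} \<in> edge_set H"
      using e(1,2) unfolding insert_commute[of _ u] edge_set_iff[OF H] by (auto simp: arcs_ends_conv)
    ultimately show False using E.no_cycle[OF tree] by metis
  qed
  ultimately show ?thesis unfolding undirected_tree_def using H by blast
qed

section \<open>Leaf-branch paths and the reducible stem\<close>

lemma ex_leaf_branch_path:
  assumes H: "graph H" and "leaf H x" "branch_vertex H b" "connected H"
  obtains p y where "leaf_branch_path H x p y"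
proof -
  interpret graph H by fact
  define Q where "Q = (\<lambda>(p, y). branch_vertex H y \<and> apath x p y)"
  have "x \<in> verts H" "b \<in> verts H" using assms by (auto simp: leaf_def branch_vertex_def)
  then have "x \<rightarrow>\<^sup>*\<^bsub>mk_symmetric H\<^esub> b"
    using assms(4) by (auto simp: connected_def strongly_connected_def)
  then have "x \<rightarrow>\<^sup>*\<^bsub>H\<^esub> b" using reachable_mk_symmetric_eq[OF sym_arcs] by simp
  then obtain p where "apath x p b" by (auto simp: reachable_apath)
  then have "Q (p, b)" using assms(3) by (simp add: Q_def)
  then obtain p' y where "Q (p', y)" "\<forall>q. Q q \<longrightarrow> length p' \<le> length (fst q)"
    using ex_has_least_nat[of Q "(p, b)" "\<lambda>q. length (fst q)"] by auto
  then have "leaf_branch_path H x p' y"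
    unfolding leaf_branch_path_def using assms(2) by (auto simp: Q_def)
  then show ?thesis using that by blast
qed

text \<open>Cutting the path at an earlier branch vertex would give a shorter path from
  \<open>x\<close> to a branch vertex.\<close>

lemma leaf_branch_path_no_branch:
  assumes H: "graph H" and lbp: "leaf_branch_path H x p y"
    and z: "z \<in> set (pre_digraph.awalk_verts H x p)" "branch_vertex H z"
  shows "z = y"
proof -
  interpret graph H by fact
  have p: "apath x p y" using lbp by (simp add: leaf_branch_path_def)
  then have "awalk x p y" by (simp add: apath_def)
  then obtain q r where qr: "p = q @ r" "awalk x q z" "awalk z r y"
    using awalk_decomp z(1) by metis
  then have "apath x q z"
    using p by (auto simp: apath_def awalk_verts_append)
  then have "length p \<le> length q" using lbp z(2) by (simp add: leaf_branch_path_def)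
  then have "r = []" using qr(1) by simp
  then show ?thesis using qr(3) by (simp add: awalk_Nil_iff)
qed

text \<open>The deleted paths are exactly the branch-free sides at branch vertices: every such side
  contains a leaf, every leaf lies in such a side, and by \<open>leg_path\<close> the leaf-branch
  path fills it.\<close>

lemma path_graph_reducible_stem:
  assumes H: "graph H" and tree: "edge_graph.spanning_tree_edges V E (edge_set H)"
    and V: "edge_graph V E" "verts H = V" "V \<noteq> {}"
    and good: "\<not> edge_graph.bad (edge_set H)"
  shows "path_graph (reducible_stem H)"
proof -
  interpret graph H by fact
  interpret E: edge_graph V E by fact
  define T where "T = edge_set H"
  have tree: "E.spanning_tree_edges T" and good: "\<not> E.bad T"
    using tree good by (simp_all add: T_def)
  have deg: "deg H v = vdeg T v" for v
    unfolding deg_edge_set[OF H] E.vdeg_nbrs[OF tree] unfolding T_def insert_commute[of v] ..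
  have leaf: "leaf H x \<longleftrightarrow> x \<in> E.leaves T" for x
    by (simp add: leaf_def E.leaves_def deg V(2))
  have branch: "branch_vertex H x \<longleftrightarrow> x \<in> E.branches T" for x
    by (simp add: branch_vertex_def E.branches_def deg V(2))
  have conn: "connected H"
    using undirected_tree_edge_set[OF H _ V] tree by (simp add: T_def undirected_tree_def)
  define R where "R = verts H - \<Union> {set (awalk_verts x p) - {y} | x p y. leaf_branch_path H x p y}"
  have "\<exists>vs. vs \<noteq> [] \<and> distinct vs \<and> R = set vs \<and>
    (\<forall>i j. i < length vs \<longrightarrow> j < length vs \<longrightarrow> ({vs ! i, vs ! j} \<in> T \<longleftrightarrow> j = Suc i \<or> i = Suc j))"
  proof (cases "E.branches T = {}")
    case True
    then have "R = V" by (auto simp: R_def leaf_branch_path_def branch V(2))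
    then show ?thesis using E.tree_path[OF tree V(3) True] by metis
  next
    case False
    have leg: "set (awalk_verts x p) - {y} = side T a b"
      if "E.leg T x a b" "leaf_branch_path H x p y" for x p y a b
    proof (rule E.leg_path[OF tree that(1)])
      have p: "apath x p y" "leaf H x" "branch_vertex H y"
        using that(2) by (auto simp: leaf_branch_path_def)
      show "x \<in> E.leaves T" "vdeg T y \<ge> 3" using p by (auto simp: leaf branch E.branches_def)
      show "path_in T (awalk_verts x p)" "awhd x p = x" "awlast x p = y"
        using apath_path_in[OF H p(1)] by (auto simp: T_def)
      fix z assume z: "z \<in> set (awalk_verts x p)" "vdeg T z \<ge> 3"
      have "z \<in> verts H" using p(1) z(1) by (auto simp: apath_def)
      then show "z = y"
        using leaf_branch_path_no_branch[OF H that(2) z(1)] z(2)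
        by (simp add: branch E.branches_def V(2))
    qed
    have "R = E.stem T"
    proof (intro equalityI subsetI)
      fix v assume v: "v \<in> R"
      have "v \<notin> side T a b" if ab: "{a, b} \<in> T" "vdeg T b \<ge> 3" "\<not> E.branchy T a b" for a b
      proof -
        obtain x where x: "x \<in> side T a b" "x \<in> E.leaves T"
          using E.ex_leaf_side[OF tree ab(1)] by blast
        have "branch_vertex H b"
          using ab E.tree_edgeD[OF tree ab(1)] by (simp add: branch E.branches_def)
        then obtain p y where "leaf_branch_path H x p y"
          using ex_leaf_branch_path[OF H _ _ conn] x(2) leaf by metis
        moreover from this have "set (awalk_verts x p) - {y} = side T a b"
          using leg ab x by (simp add: E.leg_def)
        ultimately show ?thesis using v unfolding R_def by blast
      qed
      then show "v \<in> E.stem T" using v by (auto simp: E.stem_def[OF tree] R_def V(2))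
    next
      fix v assume v: "v \<in> E.stem T"
      have "v \<notin> set (awalk_verts x p) - {y}" if lbp: "leaf_branch_path H x p y" for x p y
      proof -
        have "x \<in> E.leaves T" using lbp by (simp add: leaf_branch_path_def leaf)
        then obtain a b where ab: "{a, b} \<in> T" "x \<in> side T a b" "vdeg T b \<ge> 3" "\<not> E.branchy T a b"
          using E.ex_leg[OF tree _ False] by metis
        then have "set (awalk_verts x p) - {y} = side T a b" using leg lbp by (simp add: E.leg_def)
        then show ?thesis using v ab by (auto simp: E.stem_def[OF tree])
      qed
      then show "v \<in> R" using v by (auto simp: E.stem_def[OF tree] R_def V(2))
    qed
    then show ?thesis using E.stem_path[OF tree good False] by metis
  qed
  then obtain vs where vs: "vs \<noteq> []" "distinct vs" "R = set vs"
    "\<And>i j. i < length vs \<Longrightarrow> j < length vs \<Longrightarrow> {vs ! i, vs ! j} \<in> T \<longleftrightarrow> j = Suc i \<or> i = Suc j"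
    by blast
  have stem: "reducible_stem H = H \<restriction> R" by (simp add: reducible_stem_def R_def)
  have "arcs_ends (H \<restriction> R) = {(vs ! i, vs ! j) | i j.
         i < length vs \<and> j < length vs \<and> (j = Suc i \<or> i = Suc j)}"
  proof -
    have "arcs_ends (H \<restriction> R) = {(u, v). u \<in> set vs \<and> v \<in> set vs \<and> {u, v} \<in> T}"
      unfolding arcs_ends_induce T_def edge_set_iff[OF H] vs(3) by auto
    also have "\<dots> = {(vs ! i, vs ! j) | i j. i < length vs \<and> j < length vs \<and> {vs ! i, vs ! j} \<in> T}"
      unfolding in_set_conv_nth by blast
    also have "\<dots> = {(vs ! i, vs ! j) | i j.
         i < length vs \<and> j < length vs \<and> (j = Suc i \<or> i = Suc j)}"
      using vs(4) by blast
    finally show ?thesis .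
  qed
  moreover have "graph (H \<restriction> R)" by (rule graph_induce[OF H]) (auto simp: R_def)
  ultimately show ?thesis
    unfolding stem path_graph_def using vs(1-3) by (intro conjI exI[of _ vs]) simp_all
qed

lemma ex_spanning_subgraph:
  assumes G: "graph G" and T: "T \<subseteq> edge_set G"
  obtains H where "graph H" "spanning H G" "edge_set H = T"
proof -
  interpret graph G by fact
  define H where "H = G\<lparr>arcs := {e \<in> arcs G. {tail G e, head G e} \<in> T}\<rparr>"
  have ends: "arcs_ends H = {(u, v) \<in> arcs_ends G. {u, v} \<in> T}"
    by (auto simp: H_def arcs_ends_conv)
  have sym: "symmetric H"
    unfolding symmetric_def ends
  proof (rule symI)
    fix u v assume "(u, v) \<in> {(u, v) \<in> arcs_ends G. {u, v} \<in> T}"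
    then show "(v, u) \<in> {(u, v) \<in> arcs_ends G. {u, v} \<in> T}"
      using graph_symmetric[of u v] by (simp add: insert_commute[of v u])
  qed
  have graph_H: "graph H"
  proof
    fix e1 e2 assume "e1 \<in> arcs H" "e2 \<in> arcs H" "arc_to_ends H e1 = arc_to_ends H e2"
    then show "e1 = e2" using no_multi_arcs[of e1 e2] by (simp add: H_def arc_to_ends_def)
  qed (use sym no_loops in \<open>auto simp: H_def\<close>)
  then interpret H: graph H .
  have "spanning H G"
    unfolding spanning_def subgraph_def compatible_def
    using H.wf_digraph wf_digraph by (auto simp: H_def)
  moreover have "edge_set H = T"
  proof (intro equalityI subsetI)
    fix e assume "e \<in> T"
    moreover from this obtain a b where "e = {a, b}" "a \<rightarrow>\<^bsub>G\<^esub> b" using T by (auto simp: edge_set_def)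
    ultimately show "e \<in> edge_set H" unfolding edge_set_def ends by auto
  qed (auto simp: edge_set_def ends)
  ultimately show ?thesis using that graph_H by blast
qed

theorem theorem1p7:
  fixes G :: "('a,'b) pre_digraph"
  assumes "graph G" and "connected G" and "K14_free G"
    and "sigma 7 G \<ge> enat (card (verts G))"
  shows "\<exists>T. undirected_spanning_tree T G \<and> path_graph (reducible_stem T)"
proof -
  interpret graph G by fact
  interpret E: edge_graph "verts G" "edge_set G" by (rule edge_graph_edge_set[OF assms(1)])
  have conn: "verts G \<noteq> {}" "\<And>x y. x \<in> verts G \<Longrightarrow> y \<in> verts G \<Longrightarrow> conn (edge_set G) x y"
    using assms(2) connected_edge_set[OF assms(1)] by auto
  have dense: "card (verts G) \<le> (\<Sum>s\<in>S. card {w. {s, w} \<in> edge_set G})"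
    if S: "S \<subseteq> verts G" "card S = 7" "E.indep S" for S
  proof -
    have "independent_set G S"
      using S by (simp add: independent_set_def E.indep_def edge_set_iff[OF assms(1)])
    then have "sigma 7 G \<le> enat (\<Sum>x\<in>S. deg G x)"
      unfolding sigma_def using S(2) by (intro INF_lower) simp
    then have "enat (card (verts G)) \<le> enat (\<Sum>x\<in>S. deg G x)" using assms(4) by (rule order_trans[rotated])
    then show ?thesis by (simp add: deg_edge_set[OF assms(1)])
  qed
  obtain T where T: "E.spanning_tree_edges T" "\<not> E.bad T"
    by (rule E.exists_good_tree[OF conn K14_free_claw4_free[OF assms(1,3)] dense])
  obtain H where H: "graph H" "spanning H G" "edge_set H = T"
    using ex_spanning_subgraph[OF assms(1) E.tree_sub[OF T(1)]] .
  have V: "verts H = verts G" using H(2) by (simp add: spanning_def)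
  have "undirected_tree H"
    using undirected_tree_edge_set[OF H(1) _ E.edge_graph_axioms V conn(1)] T(1) H(3) by simp
  moreover have "path_graph (reducible_stem H)"
    using path_graph_reducible_stem[OF H(1) _ E.edge_graph_axioms V conn(1)] T H(3) by simp
  ultimately show ?thesis using H(2) unfolding undirected_spanning_tree_def by blast
qed

end
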